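(* There is an algorithm which, given any formula $F$ containing no occurrences of the blind quantifiers $\forall,\exists$, decides whether $\mathbf{CL2}\vdash F$.
   Context: Formulas are built from nonlogical atoms $p(t_1,\ldots,t_n)$ ($p$ an $n$-ary predicate letter, $t_i$ terms, where terms are variables $v_0,v_1,\ldots$ and constants $0,1,2,\ldots$) and logical atoms $\top,\bot$ by $\neg$, $\wedge,\vee$ ($n$-ary, $n\ge2$), $\rightarrow$, $\sqcap,\sqcup$ ($n$-ary, $n\ge2$) and quantifiers $\forall x,\exists x,\sqcap x,\sqcup x$ (all binding variables). Constants count as free. $G(y)$, $G(t)$ denote the result of substituting $y$, $t$ for the free occurrences of $x$ in $G(x)$. Logic $\mathbf{CL2}$. Reading $F\rightarrow G$ as $\neg F\vee G$, an occurrence of a subformula is positive (negative) if it is in the scope of an even (odd) number of $\neg$; it is a surface occurrence if not in the scope of any of $\sqcap,\sqcup,\sqcap x,\sqcup x$. The elementarization of $F$ replaces every surface occurrence of a subformula $G_1\sqcup\cdots\sqcup G_n$ or $\sqcup xG$ by $\bot$ and every surface occurrence of $G_1\sqcap\cdots\sqcap G_n$ or $\sqcap xG$ by $\top$; $F$ is stable iff its elementarization is valid in classical first-order logic (without equality or function symbols; $\top,\bot$ are truth and falsity). Rules (premises $\mapsto$ conclusion): Rule A: $\vec H\mapsto F$, where $F$ is stable and $\vec H$ is a set of formulas such that (i) whenever $F$ has a positive (resp. negative) surface occurrence of $G_1\sqcap\cdots\sqcap G_n$ (resp. $G_1\sqcup\cdots\sqcup G_n$), for each $i$, $\vec H$ contains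 the result of replacing that occurrence in $F$ by $G_i$; (ii) whenever $F$ has a positive (resp. negative) surface occurrence of $\sqcap xG(x)$ (resp. $\sqcup xG(x)$), $\vec H$ contains the result of replacing that occurrence by $G(y)$ for some variable $y$ not occurring in $F$. Rule B1: $F'\mapsto F$, where $F'$ results from $F$ by replacing a negative (resp. positive) surface occurrence of $G_1\sqcap\cdots\sqcap G_n$ (resp. $G_1\sqcup\cdots\sqcup G_n$) by some $G_i$. Rule B2: $F'\mapsto F$, where $F'$ results from $F$ by replacing a negative (resp. positive) surface occurrence of $\sqcap xG(x)$ (resp. $\sqcup xG(x)$) by $G(t)$ for a term $t$ such that, if $t$ is a variable, neither that occurrence nor any free occurrence of $x$ in $G(x)$ is in the scope of $\forall t,\exists t,\sqcap t,\sqcup t$. $\mathbf{CL2}\vdash F$ means $F$ is derivable by these rules (Rule A with empty $\vec H$ acts as an axiom rule). *)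

theory Defs
  imports Main "HOL-Library.Nat_Bijection" "HOL-Library.Countable_Set"
begin

section \<open>Formulas\<close>

datatype trm = Var nat | Const nat

text \<open>
  A predicate letter is a name together with an arity, so the letter of \<open>Atom p ts\<close> is the
  pair of \<open>p\<close> and \<open>length ts\<close>.
  \<open>Conj\<close>, \<open>Disj\<close>, \<open>Forall\<close>, \<open>Exists\<close> are the parallel connectives and the blind quantifiers;
  \<open>ChAnd\<close>, \<open>ChOr\<close>, \<open>ChAll\<close>, \<open>ChEx\<close> are their choice counterparts (square symbols).
\<close>

datatype fm =
    Atom nat "trm list"
  | Top
  | Bot
  | Neg fm
  | Conj "fm list"
  | Disj "fm list"
  | Imp fm fm
  | ChAnd "fm list"
  | ChOr "fm list"
  | Forall nat fm
  | Exists nat fm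
  | ChAll nat fm
  | ChEx nat fm

text \<open>The raw type allows connectives of any arity; formulas are the elements satisfying \<open>wff\<close>.\<close>

fun wff :: "fm \<Rightarrow> bool" where
  "wff (Atom p ts) = True"
| "wff Top = True"
| "wff Bot = True"
| "wff (Neg G) = wff G"
| "wff (Conj Gs) = (2 \<le> length Gs \<and> (\<forall>G\<in>set Gs. wff G))"
| "wff (Disj Gs) = (2 \<le> length Gs \<and> (\<forall>G\<in>set Gs. wff G))"
| "wff (Imp G H) = (wff G \<and> wff H)"
| "wff (ChAnd Gs) = (2 \<le> length Gs \<and> (\<forall>G\<in>set Gs. wff G))"
| "wff (ChOr Gs) = (2 \<le> length Gs \<and> (\<forall>G\<in>set Gs. wff G))"
| "wff (Forall x G) = wff G"
| "wff (Exists x G) = wff G"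
| "wff (ChAll x G) = wff G"
| "wff (ChEx x G) = wff G"

fun blind_free :: "fm \<Rightarrow> bool" where
  "blind_free (Atom p ts) = True"
| "blind_free Top = True"
| "blind_free Bot = True"
| "blind_free (Neg G) = blind_free G"
| "blind_free (Conj Gs) = (\<forall>G\<in>set Gs. blind_free G)"
| "blind_free (Disj Gs) = (\<forall>G\<in>set Gs. blind_free G)"
| "blind_free (Imp G H) = (blind_free G \<and> blind_free H)"
| "blind_free (ChAnd Gs) = (\<forall>G\<in>set Gs. blind_free G)"
| "blind_free (ChOr Gs) = (\<forall>G\<in>set Gs. blind_free G)"
| "blind_free (Forall x G) = False"
| "blind_free (Exists x G) = False"
| "blind_free (ChAll x G) = blind_free G"
| "blind_free (ChEx x G) = blind_free G"

text \<open>All variables occurring in a formula: free, bound, or next to a quantifier symbol.\<close>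

fun vars :: "fm \<Rightarrow> nat set" where
  "vars (Atom p ts) = {x. Var x \<in> set ts}"
| "vars Top = {}"
| "vars Bot = {}"
| "vars (Neg G) = vars G"
| "vars (Conj Gs) = (\<Union>G\<in>set Gs. vars G)"
| "vars (Disj Gs) = (\<Union>G\<in>set Gs. vars G)"
| "vars (Imp G H) = vars G \<union> vars H"
| "vars (ChAnd Gs) = (\<Union>G\<in>set Gs. vars G)"
| "vars (ChOr Gs) = (\<Union>G\<in>set Gs. vars G)"
| "vars (Forall x G) = insert x (vars G)"
| "vars (Exists x G) = insert x (vars G)"
| "vars (ChAll x G) = insert x (vars G)"
| "vars (ChEx x G) = insert x (vars G)"

fun free_vars :: "fm \<Rightarrow> nat set" where
  "free_vars (Atom p ts) = {x. Var x \<in> set ts}"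
| "free_vars Top = {}"
| "free_vars Bot = {}"
| "free_vars (Neg G) = free_vars G"
| "free_vars (Conj Gs) = (\<Union>G\<in>set Gs. free_vars G)"
| "free_vars (Disj Gs) = (\<Union>G\<in>set Gs. free_vars G)"
| "free_vars (Imp G H) = free_vars G \<union> free_vars H"
| "free_vars (ChAnd Gs) = (\<Union>G\<in>set Gs. free_vars G)"
| "free_vars (ChOr Gs) = (\<Union>G\<in>set Gs. free_vars G)"
| "free_vars (Forall x G) = free_vars G - {x}"
| "free_vars (Exists x G) = free_vars G - {x}"
| "free_vars (ChAll x G) = free_vars G - {x}"
| "free_vars (ChEx x G) = free_vars G - {x}"

text \<open>
  Plain replacement of the free occurrences of \<open>x\<close> by \<open>t\<close>, without renaming of bound variables.
  The rules of the calculus exclude capture by their side conditions.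
\<close>

fun subst :: "nat \<Rightarrow> trm \<Rightarrow> fm \<Rightarrow> fm" where
  "subst x t (Atom p ts) = Atom p (map (\<lambda>s. if s = Var x then t else s) ts)"
| "subst x t Top = Top"
| "subst x t Bot = Bot"
| "subst x t (Neg G) = Neg (subst x t G)"
| "subst x t (Conj Gs) = Conj (map (\<lambda>G. subst x t G) Gs)"
| "subst x t (Disj Gs) = Disj (map (\<lambda>G. subst x t G) Gs)"
| "subst x t (Imp G H) = Imp (subst x t G) (subst x t H)"
| "subst x t (ChAnd Gs) = ChAnd (map (\<lambda>G. subst x t G) Gs)"
| "subst x t (ChOr Gs) = ChOr (map (\<lambda>G. subst x t G) Gs)"
| "subst x t (Forall z G) = Forall z (if z = x then G else subst x t G)"
| "subst x t (Exists z G) = Exists z (if z = x then G else subst x t G)"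
| "subst x t (ChAll z G) = ChAll z (if z = x then G else subst x t G)"
| "subst x t (ChEx z G) = ChEx z (if z = x then G else subst x t G)"

text \<open>\<open>free_for x y G\<close>: no free occurrence of \<open>x\<close> in \<open>G\<close> is in the scope of a quantifier
  binding \<open>y\<close> inside \<open>G\<close>.\<close>

fun free_for :: "nat \<Rightarrow> nat \<Rightarrow> fm \<Rightarrow> bool" where
  "free_for x y (Atom p ts) = True"
| "free_for x y Top = True"
| "free_for x y Bot = True"
| "free_for x y (Neg G) = free_for x y G"
| "free_for x y (Conj Gs) = (\<forall>G\<in>set Gs. free_for x y G)"
| "free_for x y (Disj Gs) = (\<forall>G\<in>set Gs. free_for x y G)"
| "free_for x y (Imp G H) = (free_for x y G \<and> free_for x y H)"
| "free_for x y (ChAnd Gs) = (\<forall>G\<in>set Gs. free_for x y G)"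
| "free_for x y (ChOr Gs) = (\<forall>G\<in>set Gs. free_for x y G)"
| "free_for x y (Forall z G) = (z = x \<or> (z = y \<longrightarrow> x \<notin> free_vars G) \<and> free_for x y G)"
| "free_for x y (Exists z G) = (z = x \<or> (z = y \<longrightarrow> x \<notin> free_vars G) \<and> free_for x y G)"
| "free_for x y (ChAll z G) = (z = x \<or> (z = y \<longrightarrow> x \<notin> free_vars G) \<and> free_for x y G)"
| "free_for x y (ChEx z G) = (z = x \<or> (z = y \<longrightarrow> x \<notin> free_vars G) \<and> free_for x y G)"


section \<open>Classical validity and stability\<close>

fun trm_val :: "(nat \<Rightarrow> 'a) \<Rightarrow> (nat \<Rightarrow> 'a) \<Rightarrow> trm \<Rightarrow> 'a" where
  "trm_val c e (Var x) = e x"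
| "trm_val c e (Const k) = c k"

text \<open>
  Tarskian truth in the structure with universe \<open>D\<close>, interpretation \<open>P\<close> of the predicate letters
  and \<open>c\<close> of the constants, under the valuation \<open>e\<close>. Only formulas without choice operators
  are ever evaluated; the value on the others is a dummy.
\<close>

fun sat :: "'a set \<Rightarrow> (nat \<Rightarrow> 'a list \<Rightarrow> bool) \<Rightarrow> (nat \<Rightarrow> 'a) \<Rightarrow> (nat \<Rightarrow> 'a) \<Rightarrow> fm \<Rightarrow> bool" where
  "sat D P c e (Atom p ts) = P p (map (trm_val c e) ts)"
| "sat D P c e Top = True"
| "sat D P c e Bot = False"
| "sat D P c e (Neg G) = (\<not> sat D P c e G)"
| "sat D P c e (Conj Gs) = (\<forall>G\<in>set Gs. sat D P c e G)"
| "sat D P c e (Disj Gs) = (\<exists>G\<in>set Gs. sat D P c e G)"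
| "sat D P c e (Imp G H) = (sat D P c e G \<longrightarrow> sat D P c e H)"
| "sat D P c e (Forall x G) = (\<forall>d\<in>D. sat D P c (e(x := d)) G)"
| "sat D P c e (Exists x G) = (\<exists>d\<in>D. sat D P c (e(x := d)) G)"
| "sat D P c e (ChAnd Gs) = False"
| "sat D P c e (ChOr Gs) = False"
| "sat D P c e (ChAll x G) = False"
| "sat D P c e (ChEx x G) = False"

text \<open>
  HOL cannot quantify over types inside a definition, so universes range over the nonempty sets of
  natural numbers. The lemma \<open>valid_sat\<close> below shows that this is no restriction:
  a valid formula is true in every structure over every type.
\<close>

definition valid :: "fm \<Rightarrow> bool" where
  "valid F \<longleftrightarrow> (\<forall>(D :: nat set) P c e.
     D \<noteq> {} \<and> range c \<subseteq> D \<and> range e \<subseteq> D \<longrightarrow> sat D P c e F)"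

fun elementarization :: "fm \<Rightarrow> fm" where
  "elementarization (Atom p ts) = Atom p ts"
| "elementarization Top = Top"
| "elementarization Bot = Bot"
| "elementarization (Neg G) = Neg (elementarization G)"
| "elementarization (Conj Gs) = Conj (map (\<lambda>G. elementarization G) Gs)"
| "elementarization (Disj Gs) = Disj (map (\<lambda>G. elementarization G) Gs)"
| "elementarization (Imp G H) = Imp (elementarization G) (elementarization H)"
| "elementarization (Forall x G) = Forall x (elementarization G)"
| "elementarization (Exists x G) = Exists x (elementarization G)"
| "elementarization (ChAnd Gs) = Top"
| "elementarization (ChAll x G) = Top"
| "elementarization (ChOr Gs) = Bot"
| "elementarization (ChEx x G) = Bot"

definition stable :: "fm \<Rightarrow> bool" where
  "stable F \<longleftrightarrow> valid (elementarization F)"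


section \<open>The calculus CL2\<close>

text \<open>
  A surface occurrence of \<open>E\<close> in \<open>F\<close> is a decomposition \<open>F = fill C E\<close>, where the one-hole
  context \<open>C\<close> does not pass through a choice operator. Replacing that occurrence by \<open>E'\<close> yields
  \<open>fill C E'\<close>.
\<close>

datatype sctx =
    Hole
  | CNeg sctx
  | CConj "fm list" sctx "fm list"
  | CDisj "fm list" sctx "fm list"
  | CImpL sctx fm
  | CImpR fm sctx
  | CForall nat sctx
  | CExists nat sctx

primrec fill :: "sctx \<Rightarrow> fm \<Rightarrow> fm" where
  "fill Hole E = E"
| "fill (CNeg C) E = Neg (fill C E)"
| "fill (CConj Gs C Hs) E = Conj (Gs @ fill C E # Hs)"
| "fill (CDisj Gs C Hs) E = Disj (Gs @ fill C E # Hs)"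
| "fill (CImpL C H) E = Imp (fill C E) H"
| "fill (CImpR G C) E = Imp G (fill C E)"
| "fill (CForall x C) E = Forall x (fill C E)"
| "fill (CExists x C) E = Exists x (fill C E)"

primrec positive :: "sctx \<Rightarrow> bool" where
  "positive Hole = True"
| "positive (CNeg C) = (\<not> positive C)"
| "positive (CConj Gs C Hs) = positive C"
| "positive (CDisj Gs C Hs) = positive C"
| "positive (CImpL C H) = (\<not> positive C)"
| "positive (CImpR G C) = positive C"
| "positive (CForall x C) = positive C"
| "positive (CExists x C) = positive C"

abbreviation negative :: "sctx \<Rightarrow> bool" where
  "negative C \<equiv> \<not> positive C"

text \<open>The variables whose quantifiers have the hole in their scope.\<close>

primrec binders :: "sctx \<Rightarrow> nat set" where
  "binders Hole = {}"
| "binders (CNeg C) = binders C"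
| "binders (CConj Gs C Hs) = binders C"
| "binders (CDisj Gs C Hs) = binders C"
| "binders (CImpL C H) = binders C"
| "binders (CImpR G C) = binders C"
| "binders (CForall x C) = insert x (binders C)"
| "binders (CExists x C) = insert x (binders C)"

definition rule_A_premises :: "fm set \<Rightarrow> fm \<Rightarrow> bool" where
  "rule_A_premises Hs F \<longleftrightarrow>
     (\<forall>C Gs. (F = fill C (ChAnd Gs) \<and> positive C \<or> F = fill C (ChOr Gs) \<and> negative C) \<longrightarrow>
        (\<forall>G\<in>set Gs. fill C G \<in> Hs)) \<and>
     (\<forall>C x G. (F = fill C (ChAll x G) \<and> positive C \<or> F = fill C (ChEx x G) \<and> negative C) \<longrightarrow>
        (\<exists>y. y \<notin> vars F \<and> fill C (subst x (Var y) G) \<in> Hs))"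

inductive CL2 :: "fm \<Rightarrow> bool" where
  A: "\<lbrakk>wff F; stable F; rule_A_premises Hs F; \<forall>H\<in>Hs. CL2 H\<rbrakk> \<Longrightarrow> CL2 F"
| B1: "\<lbrakk>wff F;
       F = fill C (ChAnd Gs) \<and> negative C \<or> F = fill C (ChOr Gs) \<and> positive C;
       G \<in> set Gs; CL2 (fill C G)\<rbrakk> \<Longrightarrow> CL2 F"
| B2: "\<lbrakk>wff F;
       F = fill C (ChAll x G) \<and> negative C \<or> F = fill C (ChEx x G) \<and> positive C;
       \<forall>y. t = Var y \<longrightarrow> y \<notin> binders C \<and> free_for x y G;
       CL2 (fill C (subst x t G))\<rbrakk> \<Longrightarrow> CL2 F"


section \<open>Algorithms\<close>

text \<open>
  Programs for Kleene's partial recursive functions, with a big-step semantics: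
  \<open>computes f xs y\<close> means that \<open>f\<close> halts on the arguments \<open>xs\<close> with result \<open>y\<close>.
  In \<open>PrimRec\<close> and \<open>Mu\<close> the recursion or search variable is the first argument.
\<close>

datatype recf =
    Zero
  | Succ
  | Proj nat
  | Comp recf "recf list"
  | PrimRec recf recf
  | Mu recf

inductive computes :: "recf \<Rightarrow> nat list \<Rightarrow> nat \<Rightarrow> bool" where
  Zero: "computes Zero xs 0"
| Succ: "computes Succ [x] (Suc x)"
| Proj: "i < length xs \<Longrightarrow> computes (Proj i) xs (xs ! i)"
| Comp: "\<lbrakk>list_all2 (\<lambda>g y. computes g xs y) gs ys; computes f ys z\<rbrakk>
    \<Longrightarrow> computes (Comp f gs) xs z"
| PrimRec_0: "computes f xs y \<Longrightarrow> computes (PrimRec f g) (0 # xs) y"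
| PrimRec_Suc: "\<lbrakk>computes (PrimRec f g) (n # xs) y; computes g (n # y # xs) z\<rbrakk>
    \<Longrightarrow> computes (PrimRec f g) (Suc n # xs) z"
| Mu: "\<lbrakk>computes f (n # xs) 0; \<forall>m<n. \<exists>k. computes f (m # xs) (Suc k)\<rbrakk>
    \<Longrightarrow> computes (Mu f) xs n"

inductive_cases computes_ZeroE: "computes Zero xs y"
inductive_cases computes_SuccE: "computes Succ xs y"
inductive_cases computes_ProjE: "computes (Proj i) xs y"
inductive_cases computes_CompE: "computes (Comp f gs) xs y"
inductive_cases computes_PrimRec_0E: "computes (PrimRec f g) (0 # xs) y"
inductive_cases computes_PrimRec_SucE: "computes (PrimRec f g) (Suc n # xs) y"
inductive_cases computes_MuE: "computes (Mu f) xs y"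

lemma computes_deterministic:
  "computes f xs y \<Longrightarrow> computes f xs y' \<Longrightarrow> y = y'"
proof (induction arbitrary: y' rule: computes.induct)
  case (Comp xs gs ys f z)
  from Comp.prems obtain ys' where ys': "list_all2 (\<lambda>g y. computes g xs y) gs ys'"
    "computes f ys' y'" by (rule computes_CompE)
  have "ys = ys'"
    using Comp.IH(1) ys'(1) by (auto simp: list_all2_conv_all_nth intro!: nth_equalityI)
  with Comp.IH(2) ys'(2) show ?case by simp
next
  case (Mu f n xs)
  from Mu.prems have y': "computes f (y' # xs) 0" "\<forall>m<y'. \<exists>k. computes f (m # xs) (Suc k)"
    by (rule computes_MuE, blast)+
  show ?case
  proof (rule linorder_cases[of n y'])
    assume "n < y'"
    with y'(2) obtain k where "computes f (n # xs) (Suc k)" by blast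
    with Mu.IH(1) show ?thesis by fastforce
  next
    assume "y' < n"
    with Mu.IH(2) y'(1) show ?thesis by fastforce
  qed simp
next
  case (PrimRec_Suc f g n xs y z)
  from PrimRec_Suc.prems obtain y1 where
    "computes (PrimRec f g) (n # xs) y1" "computes g (n # y1 # xs) y'"
    by (rule computes_PrimRec_SucE)
  moreover from this(1) have "y = y1" by (rule PrimRec_Suc.IH(1))
  ultimately show ?case using PrimRec_Suc.IH(2) by simp
next
  case (PrimRec_0 f xs y g)
  from PrimRec_0.prems have "computes f xs y'" by (rule computes_PrimRec_0E)
  then show ?case by (rule PrimRec_0.IH)
next
  case (Zero xs)
  then show ?case by (rule computes_ZeroE) simp
next
  case (Succ x)
  then show ?case by (rule computes_SuccE) simp
next
  case (Proj i xs)
  from Proj.prems show ?case by (rule computes_ProjE) simp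
qed

text \<open>A Goedel numbering of formulas.\<close>

fun trm_code :: "trm \<Rightarrow> nat" where
  "trm_code (Var x) = prod_encode (0, x)"
| "trm_code (Const k) = prod_encode (1, k)"

fun fm_code :: "fm \<Rightarrow> nat" where
  "fm_code (Atom p ts) = prod_encode (0, prod_encode (p, list_encode (map trm_code ts)))"
| "fm_code Top = prod_encode (1, 0)"
| "fm_code Bot = prod_encode (2, 0)"
| "fm_code (Neg G) = prod_encode (3, fm_code G)"
| "fm_code (Conj Gs) = prod_encode (4, list_encode (map (\<lambda>G. fm_code G) Gs))"
| "fm_code (Disj Gs) = prod_encode (5, list_encode (map (\<lambda>G. fm_code G) Gs))"
| "fm_code (Imp G H) = prod_encode (6, prod_encode (fm_code G, fm_code H))"
| "fm_code (ChAnd Gs) = prod_encode (7, list_encode (map (\<lambda>G. fm_code G) Gs))"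
| "fm_code (ChOr Gs) = prod_encode (8, list_encode (map (\<lambda>G. fm_code G) Gs))"
| "fm_code (Forall x G) = prod_encode (9, prod_encode (x, fm_code G))"
| "fm_code (Exists x G) = prod_encode (10, prod_encode (x, fm_code G))"
| "fm_code (ChAll x G) = prod_encode (11, prod_encode (x, fm_code G))"
| "fm_code (ChEx x G) = prod_encode (12, prod_encode (x, fm_code G))"

lemma trm_code_eq_iff: "trm_code s = trm_code t \<longleftrightarrow> s = t"
  by (cases s; cases t) auto

lemma map_eq_map_iff:
  "(\<And>x y. x \<in> set xs \<Longrightarrow> f x = f y \<longleftrightarrow> x = y) \<Longrightarrow> map f xs = map f ys \<longleftrightarrow> xs = ys"
  by (induction xs arbitrary: ys) (auto simp: Cons_eq_map_conv)

lemma fm_code_eq_iff: "fm_code F = fm_code G \<longleftrightarrow> F = G"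
proof (induction F arbitrary: G)
  case (Atom p ts)
  then show ?case
    by (cases G) (simp_all add: list_encode_eq map_eq_map_iff trm_code_eq_iff)
next
  case (Conj Gs)
  then show ?case by (cases G) (simp_all add: list_encode_eq map_eq_map_iff)
next
  case (Disj Gs)
  then show ?case by (cases G) (simp_all add: list_encode_eq map_eq_map_iff)
next
  case (ChAnd Gs)
  then show ?case by (cases G) (simp_all add: list_encode_eq map_eq_map_iff)
next
  case (ChOr Gs)
  then show ?case by (cases G) (simp_all add: list_encode_eq map_eq_map_iff)
qed (case_tac G; simp)+

lemma inj_fm_code: "inj fm_code"
  by (simp add: inj_def fm_code_eq_iff)


section \<open>Validity over arbitrary universes\<close>

text \<open>
  A downward Loewenheim-Skolem argument. The elements of the countable substructure are named by
  finite terms built from the values of \<open>c\<close> and \<open>e\<close> by choosing witnesses for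
  formulas under valuations that differ from \<open>e\<close> in finitely many places.
\<close>

instance fm :: countable
  by (rule countable_classI[of fm_code]) (simp add: fm_code_eq_iff)

datatype wtree = WConst nat | WVar nat | Wit "(nat \<times> wtree) list" nat fm

instance wtree :: countable
  by countable_datatype

definition upds :: "(nat \<Rightarrow> 'a) \<Rightarrow> (nat \<times> 'a) list \<Rightarrow> nat \<Rightarrow> 'a" where
  "upds e xs = foldr (\<lambda>(x, d) e'. e'(x := d)) xs e"

lemma upds_Cons [simp]: "upds e ((x, d) # xs) = (upds e xs)(x := d)"
  by (simp add: upds_def)

lemma upds_Nil [simp]: "upds e [] = e"
  by (simp add: upds_def)

fun wval :: "'a set \<Rightarrow> (nat \<Rightarrow> 'a list \<Rightarrow> bool) \<Rightarrow> (nat \<Rightarrow> 'a) \<Rightarrow> (nat \<Rightarrow> 'a) \<Rightarrow> wtree \<Rightarrow> 'a" where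
  "wval D P c e (WConst n) = c n"
| "wval D P c e (WVar n) = e n"
| "wval D P c e (Wit xs x G) =
     (let e' = upds e (map (\<lambda>(y, t). (y, wval D P c e t)) xs);
          Q = (\<lambda>d. d \<in> D \<and> sat D P c (e'(x := d)) G)
      in if Ex Q then Eps Q else c 0)"

lemma wval_in: "range c \<subseteq> D \<Longrightarrow> range e \<subseteq> D \<Longrightarrow> wval D P c e t \<in> D"
proof (cases t)
  case (Wit xs x G)
  assume "range c \<subseteq> D"
  then show ?thesis
    unfolding Wit wval.simps Let_def
    by (auto intro: someI2_ex)
qed auto

lemma wval_witness:
  assumes "set xs \<subseteq> UNIV \<times> range (wval D P c e)"
    and "d \<in> D" "sat D P c ((upds e xs)(x := d)) G"
  shows "\<exists>d\<in>range (wval D P c e). d \<in> D \<and> sat D P c ((upds e xs)(x := d)) G"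
proof -
  have "\<forall>p\<in>set xs. \<exists>q. p = (\<lambda>(y, t). (y, wval D P c e t)) q"
    using assms(1) by fastforce
  then obtain ts where ts: "xs = map (\<lambda>(y, t). (y, wval D P c e t)) ts"
    by (metis ex_map_conv)
  let ?Q = "\<lambda>d. d \<in> D \<and> sat D P c ((upds e xs)(x := d)) G"
  have ex: "Ex ?Q" using assms by blast
  then have "wval D P c e (Wit ts x G) = Eps ?Q" by (simp add: ts)
  moreover from ex have "?Q (Eps ?Q)" by (rule someI_ex)
  ultimately show ?thesis by (metis rangeI)
qed

lemma sat_wval:
  assumes "range c \<subseteq> D" "range e \<subseteq> D"
  shows "set xs \<subseteq> UNIV \<times> range (wval D P c e) \<Longrightarrow>
    sat (range (wval D P c e)) P c (upds e xs) G \<longleftrightarrow> sat D P c (upds e xs) G"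
proof (induction G arbitrary: xs)
  case (Forall x G)
  have sub: "range (wval D P c e) \<subseteq> D" using wval_in[OF assms] by blast
  have IH: "sat (range (wval D P c e)) P c ((upds e xs)(x := d)) G \<longleftrightarrow>
      sat D P c ((upds e xs)(x := d)) G" if "d \<in> range (wval D P c e)" for d
    proof -
    have "set ((x, d) # xs) \<subseteq> UNIV \<times> range (wval D P c e)"
      using Forall.prems that by simp
    from Forall.IH[OF this] show ?thesis by (simp only: upds_Cons)
  qed
  show ?case
    using wval_witness[of xs D P c e _ x "Neg G"] Forall.prems sub IH
    by (simp only: sat.simps) blast
next
  case (Exists x G)
  have sub: "range (wval D P c e) \<subseteq> D" using wval_in[OF assms] by blast
  have IH: "sat (range (wval D P c e)) P c ((upds e xs)(x := d)) G \<longleftrightarrow>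
      sat D P c ((upds e xs)(x := d)) G" if "d \<in> range (wval D P c e)" for d
    proof -
    have "set ((x, d) # xs) \<subseteq> UNIV \<times> range (wval D P c e)"
      using Exists.prems that by simp
    from Exists.IH[OF this] show ?thesis by (simp only: upds_Cons)
  qed
  show ?case
    using wval_witness[of xs D P c e _ x G] Exists.prems sub IH
    by (simp only: sat.simps) blast
qed auto

lemma sat_iso:
  assumes "inj_on f S" "range c \<subseteq> S"
  shows "range e \<subseteq> S \<Longrightarrow>
    sat (f ` S) (\<lambda>p ds. P p (map (inv_into S f) ds)) (f \<circ> c) (f \<circ> e) G \<longleftrightarrow> sat S P c e G"
proof (induction G arbitrary: e)
  case (Atom p ts)
  have "inv_into S f (trm_val (f \<circ> c) (f \<circ> e) t) = trm_val c e t" for t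
    using assms Atom by (cases t) (auto simp: range_subsetD)
  then show ?case by (simp add: comp_def)
next
  case (Forall x G)
  have upd: "(f \<circ> e)(x := f d) = f \<circ> e(x := d)" for d by auto
  have "sat (f ` S) (\<lambda>p ds. P p (map (inv_into S f) ds)) (f \<circ> c) ((f \<circ> e)(x := f d)) G \<longleftrightarrow>
      sat S P c (e(x := d)) G" if "d \<in> S" for d
    unfolding upd using Forall.prems that by (intro Forall.IH) auto
  then show ?case by (simp only: sat.simps ball_simps bex_simps cong: ball_cong bex_cong)
next
  case (Exists x G)
  have upd: "(f \<circ> e)(x := f d) = f \<circ> e(x := d)" for d by auto
  have "sat (f ` S) (\<lambda>p ds. P p (map (inv_into S f) ds)) (f \<circ> c) ((f \<circ> e)(x := f d)) G \<longleftrightarrow>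
      sat S P c (e(x := d)) G" if "d \<in> S" for d
    unfolding upd using Exists.prems that by (intro Exists.IH) auto
  then show ?case by (simp only: sat.simps ball_simps bex_simps cong: ball_cong bex_cong)
qed auto

lemma valid_sat:
  fixes D :: "'a set"
  assumes "valid F" "range c \<subseteq> D" "range e \<subseteq> D"
  shows "sat D P c e F"
proof -
  define S where "S = range (wval D P c e)"
  define f where "f = to_nat_on S"
  have inj: "inj_on f S" unfolding f_def S_def by (intro inj_on_to_nat_on) auto
  have "c n \<in> S" "e n \<in> S" for n
    unfolding S_def by (metis wval.simps(1) rangeI, metis wval.simps(2) rangeI)
  then have cS: "range c \<subseteq> S" and eS: "range e \<subseteq> S" by auto
  have "f ` S \<noteq> {}" "range (f \<circ> c) \<subseteq> f ` S" "range (f \<circ> e) \<subseteq> f ` S"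
    using cS eS by (auto simp: S_def)
  then have "sat (f ` S) (\<lambda>p ds. P p (map (inv_into S f) ds)) (f \<circ> c) (f \<circ> e) F"
    by (intro assms(1)[unfolded valid_def, rule_format] conjI)
  then have "sat S P c e F" using sat_iso[OF inj cS eS] by simp
  then show ?thesis
    using sat_wval[OF assms(2,3), of "[]"] by (simp add: S_def)
qed

end

theory Submission
  imports Defs
begin

text \<open>
  Every premise of a rule has fewer choice operators than its conclusion, so derivability can be
  decided by recursion on premises once each conclusion has finitely many candidate premises. CL2 is
  invariant under permutations of the variables and of the constants. Hence, with
  \<open>N = fm_code F + 1\<close>, which exceeds every variable and constant of \<open>F\<close>, rule A may always use the
  fresh variable \<open>N\<close>, and rule B2 only needs the variables and constants up to \<open>N\<close>: a larger one can
  be swapped with \<open>N\<close> without changing \<open>F\<close>. Without blind quantifiers, stability is a propositional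
  tautology check.

  Computability is established for functions between types with a fixed injective encoding into the
  natural numbers, a class closed under general well-founded recursion.
\<close>

section \<open>Partial recursive functions\<close>

text \<open>Blind quantifiers are excluded because of stability: with them an elementarization can
  be any first-order formula, and validity of such formulas is undecidable. Their absence also makes
  \<open>binders C\<close> empty for every surface context, so the only capture that rule B2 could
  cause lies inside the instantiated subformula. The swaps work because a renaming that fixes
  \<open>F\<close> also fixes the context and the choice subformula at each surface occurrence. In a
  premise it therefore moves nothing but the inserted term, so one derivable premise turns into
  another premise of the same \<open>F\<close>. On the computational side, the recursion equation of
  \<open>CL2\<close> is available only for well-formed formulas without blind quantifiers, and a
  search halts only where a solution exists. Computability is therefore stated relative to a domain,
  and a case distinction must not run the branch that is not taken.\<close>

lemma computes_Comp1:
  "computes g xs y \<Longrightarrow> computes f [y] z \<Longrightarrow> computes (Comp f [g]) xs z"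
  by (rule computes.Comp[where ys = "[y]"]) auto

lemma computes_Comp2:
  "computes g xs y \<Longrightarrow> computes h xs y' \<Longrightarrow> computes f [y, y'] z \<Longrightarrow> computes (Comp f [g, h]) xs z"
  by (rule computes.Comp[where ys = "[y, y']"]) auto

lemma computes_Proj_eq: "i < length xs \<Longrightarrow> xs ! i = y \<Longrightarrow> computes (Proj i) xs y"
  using computes.Proj by blast

fun const_rf :: "nat \<Rightarrow> recf" where
  "const_rf 0 = Zero"
| "const_rf (Suc n) = Comp Succ [const_rf n]"

lemma computes_const_rf: "computes (const_rf n) xs n"
  by (induction n) (auto intro: computes.intros computes_Comp1)

definition add_rf :: recf where
  "add_rf = PrimRec (Proj 0) (Comp Succ [Proj 1])"

lemma computes_add_rf: "computes add_rf [m, n] (m + n)"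
  unfolding add_rf_def
  by (induction m) (auto intro!: computes.Succ computes.PrimRec_0 computes_Comp1 computes_Proj_eq
      intro: computes.PrimRec_Suc)

definition pred_rf :: recf where
  "pred_rf = PrimRec Zero (Proj 0)"

lemma computes_pred_rf: "computes pred_rf [n] (n - 1)"
  unfolding pred_rf_def
  by (induction n) (auto intro!: computes.Zero computes.PrimRec_0 computes_Proj_eq
      intro: computes.PrimRec_Suc)

text \<open>Primitive recursion runs over the first argument, which has to be the subtrahend; the
  outer projections swap the arguments accordingly.\<close>

definition sub_rf :: recf where
  "sub_rf = Comp (PrimRec (Proj 0) (Comp pred_rf [Proj 1])) [Proj 1, Proj 0]"

lemma computes_sub_rf: "computes sub_rf [m, n] (m - n)"
proof -
  have "computes (PrimRec (Proj 0) (Comp pred_rf [Proj 1])) [n, m] (m - n)"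
  proof (induction n)
    case (Suc n)
    have "computes (Comp pred_rf [Proj 1]) [n, m - n, m] (m - n - 1)"
      by (rule computes_Comp1[OF _ computes_pred_rf]) (simp add: computes_Proj_eq)
    with Suc show ?case by (auto intro: computes.PrimRec_Suc)
  qed (auto intro!: computes.PrimRec_0 computes_Proj_eq)
  then show ?thesis
    unfolding sub_rf_def by (auto intro!: computes_Comp2 computes_Proj_eq)
qed

definition triangle_rf :: recf where
  "triangle_rf = PrimRec Zero (Comp add_rf [Proj 1, Comp Succ [Proj 0]])"

lemma computes_triangle_rf: "computes triangle_rf [n] (triangle n)"
  unfolding triangle_rf_def
proof (induction n)
  case (Suc n)
  have "computes (Comp add_rf [Proj 1, Comp Succ [Proj 0]]) [n, triangle n] (triangle n + Suc n)"
    by (rule computes_Comp2[OF _ _ computes_add_rf])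
      (auto intro!: computes_Comp1 computes_Proj_eq computes.Succ)
  with Suc show ?case by (auto intro: computes.PrimRec_Suc)
qed (auto intro!: computes.PrimRec_0 computes.Zero)

text \<open>\<open>prod_encode (m, n)\<close> is \<open>triangle (m + n) + m\<close>, so
  \<open>m\<close> is recovered by subtracting the triangular number of the diagonal
  \<open>m + n\<close>.\<close>

definition pair_rf :: recf where
  "pair_rf = Comp add_rf [Comp triangle_rf [add_rf], Proj 0]"

lemma computes_pair_rf: "computes pair_rf [m, n] (prod_encode (m, n))"
  unfolding pair_rf_def prod_encode_def
  by (auto intro!: computes_Comp2[OF _ _ computes_add_rf] computes_Comp1[OF computes_add_rf]
      computes_triangle_rf computes_Proj_eq)

text \<open>The sum of the two components of a pair code \<open>z\<close> is the least \<open>n\<close> with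
  \<open>z < triangle (Suc n)\<close>.\<close>

definition diag_rf :: recf where
  "diag_rf = Mu (Comp sub_rf [Comp Succ [Proj 1], Comp triangle_rf [Comp Succ [Proj 0]]])"

lemma triangle_mono: "m \<le> n \<Longrightarrow> triangle m \<le> triangle n"
  by (induction n rule: dec_induct) auto

lemma computes_diag_rf: "computes diag_rf [prod_encode (a, b)] (a + b)"
proof -
  let ?z = "prod_encode (a, b)"
  \<comment> \<open>Truncated subtraction gives 0 exactly when \<open>?z < triangle (Suc n)\<close>,
    which turns the inequality into the test for zero that \<open>Mu\<close> performs.\<close>
  have step: "computes (Comp sub_rf [Comp Succ [Proj 1], Comp triangle_rf [Comp Succ [Proj 0]]])
      [n, ?z] (Suc ?z - triangle (Suc n))" for n
    by (rule computes_Comp2[OF _ _ computes_sub_rf])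
      (auto intro!: computes_Comp1 computes_Proj_eq computes.Succ computes_triangle_rf
        simp del: triangle_Suc)
  have "Suc ?z - triangle (Suc (a + b)) = 0"
    by (simp add: prod_encode_def)
  moreover have "\<exists>k. Suc ?z - triangle (Suc n) = Suc k" if "n < a + b" for n
  proof -
    have "triangle (Suc n) \<le> triangle (a + b)" using that by (intro triangle_mono) simp
    then show ?thesis
      by (intro exI[of _ "?z - triangle (Suc n)"]) (simp add: prod_encode_def Suc_diff_le)
  qed
  ultimately show ?thesis
    unfolding diag_rf_def using step by (intro computes.Mu) metis+
qed

definition fst_rf :: recf where
  "fst_rf = Comp sub_rf [Proj 0, Comp triangle_rf [diag_rf]]"

definition snd_rf :: recf where
  "snd_rf = Comp sub_rf [diag_rf, fst_rf]"

lemma computes_fst_rf: "computes fst_rf [prod_encode (a, b)] a"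
proof -
  have "computes fst_rf [prod_encode (a, b)] (prod_encode (a, b) - triangle (a + b))"
    unfolding fst_rf_def
    by (rule computes_Comp2[OF _ _ computes_sub_rf])
      (auto intro!: computes_Comp1[OF computes_diag_rf] computes_Proj_eq computes_triangle_rf)
  then show ?thesis by (simp add: prod_encode_def)
qed

lemma computes_snd_rf: "computes snd_rf [prod_encode (a, b)] b"
proof -
  have "computes snd_rf [prod_encode (a, b)] (a + b - a)"
    unfolding snd_rf_def
    by (rule computes_Comp2[OF computes_diag_rf computes_fst_rf computes_sub_rf])
  then show ?thesis by simp
qed

text \<open>Primitive recursion with a zero base case runs \<open>r\<close> only if the test \<open>b\<close> yields 1. In contrast to
  an arithmetical case distinction, this does not require \<open>r\<close> to halt when \<open>b\<close> yields 0.\<close>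

definition guard_rf :: "recf \<Rightarrow> recf \<Rightarrow> recf" where
  "guard_rf b r = Comp (PrimRec Zero (Comp r [Proj 2])) [b, Proj 0]"

lemma computes_guard_rf_0: "computes b [x] 0 \<Longrightarrow> computes (guard_rf b r) [x] 0"
  unfolding guard_rf_def
  by (auto intro!: computes_Comp2 computes.PrimRec_0 computes.Zero computes_Proj_eq)

lemma computes_guard_rf_1:
  assumes "computes b [x] (Suc 0)" "computes r [x] y"
  shows "computes (guard_rf b r) [x] y"
proof -
  have "computes (Comp r [Proj 2]) [0, 0, x] y"
    using assms by (auto intro!: computes_Comp1 computes_Proj_eq)
  then have "computes (PrimRec Zero (Comp r [Proj 2])) [Suc 0, x] y"
    by (auto intro!: computes.PrimRec_Suc[where y = 0] computes.PrimRec_0 computes.Zero)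
  then show ?thesis
    unfolding guard_rf_def using assms(1) by (auto intro!: computes_Comp2 computes_Proj_eq)
qed

section \<open>Computable functions between encoded types\<close>

text \<open>Injectivity lets equality be tested on codes. The range need not be all of
  \<open>nat\<close>, since programs are only specified on codes of elements.\<close>

class enc =
  fixes enc :: "'a \<Rightarrow> nat"
  assumes enc_eq_iff: "enc x = enc y \<longleftrightarrow> x = y"

instantiation nat :: enc
begin
definition enc_nat :: "nat \<Rightarrow> nat" where [simp]: "enc_nat n = n"
instance by standard simp
end

instantiation bool :: enc
begin
definition enc_bool :: "bool \<Rightarrow> nat" where [simp]: "enc_bool b = (if b then 1 else 0)"
instance by standard auto
end

instantiation prod :: (enc, enc) enc
begin
definition enc_prod :: "'a \<times> 'b \<Rightarrow> nat" where
  "enc_prod p = prod_encode (enc (fst p), enc (snd p))"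
instance by standard (auto simp: enc_prod_def enc_eq_iff prod_eq_iff)
end

instantiation list :: (enc) enc
begin
definition enc_list :: "'a list \<Rightarrow> nat" where "enc_list xs = list_encode (map enc xs)"
instance by standard (simp add: enc_list_def list_encode_eq map_eq_map_iff enc_eq_iff)
end

instantiation trm :: enc
begin
definition enc_trm :: "trm \<Rightarrow> nat" where [simp]: "enc_trm = trm_code"
instance by standard (simp add: trm_code_eq_iff)
end

instantiation fm :: enc
begin
definition enc_fm :: "fm \<Rightarrow> nat" where [simp]: "enc_fm = fm_code"
instance by standard (simp add: fm_code_eq_iff)
end

lemma enc_Pair [simp]: "enc (a, b) = prod_encode (enc a, enc b)"
  by (simp add: enc_prod_def)

lemma enc_Nil [simp]: "enc [] = 0"
  by (simp add: enc_list_def)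

lemma enc_Cons [simp]: "enc (x # xs) = Suc (enc (x, xs))"
  by (simp add: enc_list_def)

text \<open>The domain is a promise about the argument: outside \<open>D\<close> the program may
  give any result or diverge.\<close>

definition computable_on :: "'a::enc set \<Rightarrow> ('a \<Rightarrow> 'b::enc) \<Rightarrow> bool" where
  "computable_on D f \<longleftrightarrow> (\<exists>r. \<forall>x\<in>D. computes r [enc x] (enc (f x)))"

abbreviation computable :: "('a::enc \<Rightarrow> 'b::enc) \<Rightarrow> bool" where
  "computable \<equiv> computable_on UNIV"

lemma computable_onI: "(\<And>x. x \<in> D \<Longrightarrow> computes r [enc x] (enc (f x))) \<Longrightarrow> computable_on D f"
  unfolding computable_on_def by blast

lemma computable_on_subset: "computable_on D f \<Longrightarrow> D' \<subseteq> D \<Longrightarrow> computable_on D' f"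
  unfolding computable_on_def by blast

lemma computable_on_comp:
  assumes "computable_on E f" "computable_on D g" "g ` D \<subseteq> E"
  shows "computable_on D (\<lambda>x. f (g x))"
proof -
  obtain r s where "\<And>y. y \<in> E \<Longrightarrow> computes r [enc y] (enc (f y))"
    "\<And>x. x \<in> D \<Longrightarrow> computes s [enc x] (enc (g x))"
    using assms(1,2) unfolding computable_on_def by blast
  with assms(3) show ?thesis
    by (intro computable_onI[where r = "Comp r [s]"] computes_Comp1) auto
qed

lemma computable_comp: "computable f \<Longrightarrow> computable_on D g \<Longrightarrow> computable_on D (\<lambda>x. f (g x))"
  by (rule computable_on_comp) auto

text \<open>Reduces a function on a datatype to arithmetic on its Goedel numbers; destructors of
  formulas are treated in this way.\<close>

lemma computable_recode:
  assumes "computable g" "\<And>x. x \<in> D \<Longrightarrow> enc (f x) = enc (g (enc x))"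
  shows "computable_on D f"
  using assms unfolding computable_on_def by (metis UNIV_I enc_nat_def)

lemma computable_id: "computable_on D (\<lambda>x. x)"
  by (rule computable_onI[where r = "Proj 0"]) (simp add: computes_Proj_eq)

lemma computable_const: "computable_on D (\<lambda>x. c)"
  by (rule computable_onI) (rule computes_const_rf)

text \<open>Programs see only codes. A constructor whose code is that of a tuple therefore inherits
  computability from the tuple.\<close>

lemma computable_same_code:
  assumes "computable_on D f" "\<And>x. x \<in> D \<Longrightarrow> enc (g x) = enc (f x)"
  shows "computable_on D g"
  using assms unfolding computable_on_def by metis

text \<open>Allows calculations that first rewrite a function and then show the rewritten one
  computable.\<close>

lemma computable_trans [trans]: "f = g \<Longrightarrow> computable g \<Longrightarrow> computable f"
  by simp

lemma computable_Pair:
  assumes "computable_on D f" "computable_on D g"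
  shows "computable_on D (\<lambda>x. (f x, g x))"
proof -
  obtain r s where "\<And>x. x \<in> D \<Longrightarrow> computes r [enc x] (enc (f x))"
    "\<And>x. x \<in> D \<Longrightarrow> computes s [enc x] (enc (g x))"
    using assms unfolding computable_on_def by blast
  then show ?thesis
    by (intro computable_onI[where r = "Comp pair_rf [r, s]"])
      (auto intro!: computes_Comp2 computes_pair_rf)
qed

lemma computable_fst: "computable_on D f \<Longrightarrow> computable_on D (\<lambda>x. fst (f x))"
  by (erule computable_comp[rotated])
    (rule computable_onI[where r = fst_rf], simp add: enc_prod_def computes_fst_rf)

lemma computable_snd: "computable_on D f \<Longrightarrow> computable_on D (\<lambda>x. snd (f x))"
  by (erule computable_comp[rotated])
    (rule computable_onI[where r = snd_rf], simp add: enc_prod_def computes_snd_rf)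

lemma computable_Suc: "computable_on D f \<Longrightarrow> computable_on D (\<lambda>x. Suc (f x))"
  by (erule computable_comp[rotated]) (rule computable_onI[where r = Succ], simp add: computes.Succ)

lemma computable_enc: "computable_on D f \<Longrightarrow> computable_on D (\<lambda>x. enc (f x))"
  by (erule computable_same_code) simp

lemma computable_prod_decode: "computable_on D f \<Longrightarrow> computable_on D (\<lambda>x. prod_decode (f x))"
  by (erule computable_same_code) (simp add: enc_prod_def)

lemma computable_diff:
  fixes f g :: "'a::enc \<Rightarrow> nat"
  assumes "computable_on D f" "computable_on D g"
  shows "computable_on D (\<lambda>x. f x - g x)"
proof -
  obtain r s where "\<And>x. x \<in> D \<Longrightarrow> computes r [enc x] (f x)"
    "\<And>x. x \<in> D \<Longrightarrow> computes s [enc x] (g x)"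
    using assms unfolding computable_on_def enc_nat_def by blast
  then show ?thesis
    by (intro computable_onI[where r = "Comp sub_rf [r, s]"])
      (auto intro!: computes_Comp2 computes_sub_rf)
qed

lemma computable_add:
  fixes f g :: "'a::enc \<Rightarrow> nat"
  assumes "computable_on D f" "computable_on D g"
  shows "computable_on D (\<lambda>x. f x + g x)"
proof -
  obtain r s where "\<And>x. x \<in> D \<Longrightarrow> computes r [enc x] (f x)"
    "\<And>x. x \<in> D \<Longrightarrow> computes s [enc x] (g x)"
    using assms unfolding computable_on_def enc_nat_def by blast
  then show ?thesis
    by (intro computable_onI[where r = "Comp add_rf [r, s]"])
      (auto intro!: computes_Comp2 computes_add_rf)
qed

lemma computable_not: "computable_on D P \<Longrightarrow> computable_on D (\<lambda>x. \<not> P x)"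
  by (rule computable_same_code[where f = "\<lambda>x. 1 - enc (P x)"])
    (intro computable_diff computable_const computable_enc, assumption, simp)

lemma computable_eq:
  assumes "computable_on D f" "computable_on D g"
  shows "computable_on D (\<lambda>x. f x = g x)"
proof (rule computable_same_code)
  show "computable_on D (\<lambda>x. 1 - ((enc (f x) - enc (g x)) + (enc (g x) - enc (f x))))"
    by (intro computable_diff computable_add computable_const computable_enc assms)
  show "enc (f x = g x) = enc (1 - ((enc (f x) - enc (g x)) + (enc (g x) - enc (f x))))" for x
    using enc_eq_iff[of "f x" "g x"] by auto
qed

text \<open>The program adds two guarded branches. The branch whose test fails is never run and
  contributes 0, so each of \<open>f\<close> and \<open>g\<close> has to be computable only on its
  own part of \<open>D\<close>.\<close>

lemma computable_on_if:
  assumes "computable_on D P" "computable_on {x\<in>D. P x} f" "computable_on {x\<in>D. \<not> P x} g"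
  shows "computable_on D (\<lambda>x. if P x then f x else g x)"
proof -
  obtain p where p: "\<And>x. x \<in> D \<Longrightarrow> computes p [enc x] (enc (P x))"
    using assms(1) unfolding computable_on_def enc_nat_def by blast
  obtain q where q: "\<And>x. x \<in> D \<Longrightarrow> computes q [enc x] (enc (\<not> P x))"
    using computable_not[OF assms(1)] unfolding computable_on_def enc_nat_def by blast
  obtain r where r: "\<And>x. x \<in> {x\<in>D. P x} \<Longrightarrow> computes r [enc x] (enc (f x))"
    using assms(2) unfolding computable_on_def enc_nat_def by blast
  obtain s where s: "\<And>x. x \<in> {x\<in>D. \<not> P x} \<Longrightarrow> computes s [enc x] (enc (g x))"
    using assms(3) unfolding computable_on_def enc_nat_def by blast
  show ?thesis
  proof (rule computable_onI[where r = "Comp add_rf [guard_rf p r, guard_rf q s]"])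
    fix x assume x: "x \<in> D"
    show "computes (Comp add_rf [guard_rf p r, guard_rf q s]) [enc x]
        (enc (if P x then f x else g x))"
    proof (cases "P x")
      case True
      have "computes (Comp add_rf [guard_rf p r, guard_rf q s]) [enc x] (enc (f x) + 0)"
        using p[OF x] q[OF x] r[of x] x True
        by (intro computes_Comp2[OF _ _ computes_add_rf] computes_guard_rf_0 computes_guard_rf_1) auto
      with True show ?thesis by simp
    next
      case False
      have "computes (Comp add_rf [guard_rf p r, guard_rf q s]) [enc x] (0 + enc (g x))"
        using p[OF x] q[OF x] s[of x] x False
        by (intro computes_Comp2[OF _ _ computes_add_rf] computes_guard_rf_0 computes_guard_rf_1) auto
      with False show ?thesis by simp
    qed
  qed
qed

lemma computable_if:
  "computable P \<Longrightarrow> computable f \<Longrightarrow> computable g \<Longrightarrow> computable (\<lambda>x. if P x then f x else g x)"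
  by (intro computable_on_if) (auto intro: computable_on_subset)

lemma computable_conj:
  assumes "computable P" "computable Q" shows "computable (\<lambda>x. P x \<and> Q x)"
proof -
  have "(\<lambda>x. P x \<and> Q x) = (\<lambda>x. if P x then Q x else False)" by auto
  then show ?thesis using assms by (simp only: computable_if computable_const)
qed

lemma computable_disj:
  assumes "computable P" "computable Q" shows "computable (\<lambda>x. P x \<or> Q x)"
proof -
  have "(\<lambda>x. P x \<or> Q x) = (\<lambda>x. if P x then True else Q x)" by auto
  then show ?thesis using assms by (simp only: computable_if computable_const)
qed

lemma computable_imp:
  assumes "computable P" "computable Q" shows "computable (\<lambda>x. P x \<longrightarrow> Q x)"
proof -
  have "(\<lambda>x. P x \<longrightarrow> Q x) = (\<lambda>x. if P x then Q x else True)" by auto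
  then show ?thesis using assms by (simp only: computable_if computable_const)
qed

lemma computable_le:
  fixes f g :: "'a::enc \<Rightarrow> nat"
  assumes "computable f" "computable g" shows "computable (\<lambda>x. f x \<le> g x)"
proof -
  have "(\<lambda>x. f x \<le> g x) = (\<lambda>x. f x - g x = 0)" by auto
  then show ?thesis using assms by (simp only: computable_eq computable_diff computable_const)
qed

lemma computable_case_prod:
  "computable (\<lambda>x. f x (fst (p x)) (snd (p x))) \<Longrightarrow> computable (\<lambda>x. case p x of (a, b) \<Rightarrow> f x a b)"
  by (simp add: split_def)

text \<open>Iteration is primitive recursion that ignores its counter. Loops over lists and the
  stack machine for general recursion are built on it.\<close>

lemma computable_funpow:
  fixes s :: "'b::enc \<Rightarrow> 'b" and f :: "'a::enc \<Rightarrow> 'b"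
  assumes s: "computable s" and n: "computable n" and f: "computable f"
  shows "computable (\<lambda>x. (s ^^ n x) (f x))"
proof -
  obtain r where r: "\<And>y. computes r [enc y] (enc (s y))"
    using s unfolding computable_on_def enc_nat_def by blast
  obtain rn rf where rn: "\<And>x. computes rn [enc x] (n x)" and rf: "\<And>x. computes rf [enc x] (enc (f x))"
    using n f unfolding computable_on_def enc_nat_def by blast
  let ?r = "PrimRec (Proj 0) (Comp r [Proj 1])"
  have "computes ?r [k, enc y] (enc ((s ^^ k) y))" for k y
  proof (induction k)
    case (Suc k)
    have "computes (Comp r [Proj 1]) [k, enc ((s ^^ k) y), enc y] (enc (s ((s ^^ k) y)))"
      by (rule computes_Comp1[OF _ r]) (simp add: computes_Proj_eq)
    with Suc show ?case by (auto intro: computes.PrimRec_Suc)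
  qed (auto intro!: computes.PrimRec_0 computes_Proj_eq)
  then show ?thesis
    by (intro computable_onI[where r = "Comp ?r [rn, rf]"] computes_Comp2[OF rn rf])
qed

lemma computable_on_Least:
  fixes P :: "'a::enc \<Rightarrow> nat \<Rightarrow> bool"
  assumes P: "computable (\<lambda>z. P (fst z) (snd z))"
  shows "computable_on {x. \<exists>n. P x n} (\<lambda>x. LEAST n. P x n)"
proof -
  obtain r where r: "\<And>z. computes r [enc z] (enc (\<not> P (fst z) (snd z)))"
    using computable_not[OF P] unfolding computable_on_def enc_nat_def by blast
  \<comment> \<open>\<open>Mu\<close> searches for a zero and passes the search variable first;
    hence the negated predicate and the swapped pair.\<close>
  let ?f = "Comp r [Comp pair_rf [Proj 1, Proj 0]]"
  have f: "computes ?f [n, enc x] (enc (\<not> P x n))" for n x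
  proof -
    have "computes (Comp pair_rf [Proj 1, Proj 0]) [n, enc x] (enc (x, n))"
      by (simp, intro computes_Comp2[OF _ _ computes_pair_rf] computes_Proj_eq) auto
    from computes_Comp1[OF this r] show ?thesis by simp
  qed
  show ?thesis
  proof (rule computable_onI[where r = "Mu ?f"])
    fix x assume "x \<in> {x. \<exists>n. P x n}"
    then have L: "P x (LEAST n. P x n)" by (auto intro: LeastI_ex)
    have "\<exists>k. computes ?f [m, enc x] (Suc k)" if "m < (LEAST n. P x n)" for m
      using f[of m x] not_less_Least[OF that] by auto
    moreover have "computes ?f [LEAST n. P x n, enc x] 0"
      using f[of "LEAST n. P x n" x] L by simp
    ultimately show "computes (Mu ?f) [enc x] (enc (LEAST n. P x n))"
      by (auto intro: computes.Mu)
  qed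
qed

section \<open>Lists\<close>

lemma computable_Cons:
  "computable_on D f \<Longrightarrow> computable_on D g \<Longrightarrow> computable_on D (\<lambda>x. f x # g x)"
  by (rule computable_same_code[where f = "\<lambda>x. Suc (enc (f x, g x))"])
    (intro computable_Suc computable_enc computable_Pair, assumption+, simp)

lemma computable_case_list:
  assumes l: "computable l" and a: "computable a"
    and b: "computable (\<lambda>z. b (fst z) (fst (snd z)) (snd (snd z)))"
  shows "computable (\<lambda>x. case l x of [] \<Rightarrow> a x | y # ys \<Rightarrow> b x y ys)"
proof -
  have uncons: "computable_on {x. l x \<noteq> []} (\<lambda>x. (x, hd (l x), tl (l x)))"
  proof (intro computable_Pair computable_id)
    have "computable_on {x. l x \<noteq> []} (\<lambda>x. (hd (l x), tl (l x)))"
    \<comment> \<open>The code of a nonempty list is the successor of the code of the pair of its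
      head and tail. On \<open>[]\<close> the predecessor has no such meaning, so the domain
      excludes it.\<close>
    proof (rule computable_same_code[where f = "\<lambda>x. enc (l x) - 1"])
      show "computable_on {x. l x \<noteq> []} (\<lambda>x. enc (l x) - 1)"
        by (intro computable_diff computable_const computable_enc computable_on_subset[OF l]) auto
      fix x assume "x \<in> {x. l x \<noteq> []}"
      then show "enc (hd (l x), tl (l x)) = enc (enc (l x) - 1)"
        by (cases "l x") auto
    qed
    from computable_fst[OF this] computable_snd[OF this]
    show "computable_on {x. l x \<noteq> []} (\<lambda>x. hd (l x))" "computable_on {x. l x \<noteq> []} (\<lambda>x. tl (l x))"
      by simp_all
  qed
  have "computable (\<lambda>x. if l x = [] then a x else b x (hd (l x)) (tl (l x)))"
  proof (rule computable_on_if)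
    show "computable (\<lambda>x. l x = [])" by (intro computable_eq l computable_const)
    show "computable_on {x \<in> UNIV. l x = []} a" using a by (rule computable_on_subset) simp
    show "computable_on {x \<in> UNIV. l x \<noteq> []} (\<lambda>x. b x (hd (l x)) (tl (l x)))"
      using computable_comp[OF b uncons] by simp
  qed
  moreover have "(\<lambda>x. if l x = [] then a x else b x (hd (l x)) (tl (l x))) =
      (\<lambda>x. case l x of [] \<Rightarrow> a x | y # ys \<Rightarrow> b x y ys)"
    by (auto split: list.split)
  ultimately show ?thesis by simp
qed

text \<open>Makes the code of a list, which is at hand, a sufficient number of loop steps for
  traversing it.\<close>

lemma length_le_enc: "length xs \<le> enc xs"
proof (induction xs)
  case (Cons x xs)
  have "enc xs \<le> enc (x, xs)" by (simp add: le_prod_encode_2)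
  with Cons show ?case by (simp del: enc_Pair)
qed simp

lemmas computable_basic =
  computable_id computable_const computable_Pair computable_fst computable_snd computable_Suc
  computable_enc computable_prod_decode computable_diff computable_add
  computable_not computable_eq computable_if computable_conj computable_disj computable_imp
  computable_le computable_case_prod computable_Cons computable_case_list

lemma computable_foldl:
  assumes f: "computable (\<lambda>z. f (fst z) (fst (snd z)) (snd (snd z)))"
    and a: "computable a" and l: "computable l"
  shows "computable (\<lambda>x. foldl (f x) (a x) (l x))"
proof -
  \<comment> \<open>The state holds the parameter, the accumulator and the rest of the list. It
    stays put once the list is used up, so surplus iterations do no harm.\<close>
  define s :: "'a \<times> 'b \<times> 'c list \<Rightarrow> 'a \<times> 'b \<times> 'c list" where
    "s z = (case snd (snd z) of [] \<Rightarrow> z | y # ys \<Rightarrow> (fst z, f (fst z) (fst (snd z)) y, ys))" for z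
  have f': "computable (\<lambda>w. f (p w) (q w) (t w))"
    if "computable p" "computable q" "computable t" for p q and t :: "('a \<times> 'b \<times> 'c list) \<times> 'c \<times> 'c list \<Rightarrow> 'c"
    using computable_comp[OF f computable_Pair[OF that(1) computable_Pair[OF that(2,3)]]] by simp
  have s: "computable s"
    unfolding s_def by (intro computable_basic f')
  have run: "(s ^^ n) (x, b, ys) = (x, foldl (f x) b ys, [])" if "length ys \<le> n" for n x b ys
    using that
  proof (induction n arbitrary: b ys)
    case (Suc n)
    then show ?case
      by (cases ys) (simp_all add: funpow_Suc_right s_def del: funpow.simps)
  qed simp
  have "computable (\<lambda>x. fst (snd ((s ^^ enc (l x)) (x, a x, l x))))"
    by (intro computable_basic computable_funpow s a l)
  then show ?thesis by (simp add: run length_le_enc)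
qed

lemma computable_rev:
  assumes "computable l" shows "computable (\<lambda>x. rev (l x))"
proof -
  have "foldl (\<lambda>acc y. y # acc) acc ys = rev ys @ acc" for acc ys :: "'b list"
    by (induction ys arbitrary: acc) auto
  then have "(\<lambda>x. rev (l x)) = (\<lambda>x. foldl (\<lambda>acc y. y # acc) [] (l x))" by simp
  also have "computable \<dots>" by (intro computable_foldl computable_basic assms)
  finally show ?thesis .
qed

lemma computable_foldr:
  assumes f: "computable (\<lambda>z. f (fst z) (fst (snd z)) (snd (snd z)))"
    and a: "computable a" and l: "computable l"
  shows "computable (\<lambda>x. foldr (f x) (l x) (a x))"
proof -
  have f': "computable (\<lambda>z. f (fst z) (snd (snd z)) (fst (snd z)))"
    using computable_comp[OF f, of _ "\<lambda>z. (fst z, snd (snd z), fst (snd z))"]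
    by (simp add: computable_basic)
  have "(\<lambda>x. foldr (f x) (l x) (a x)) = (\<lambda>x. foldl (\<lambda>b y. f x y b) (a x) (rev (l x)))"
    by (simp add: foldr_conv_foldl)
  also have "computable \<dots>" by (intro computable_foldl f' a computable_rev l)
  finally show ?thesis .
qed

lemma computable_append:
  assumes "computable f" "computable g" shows "computable (\<lambda>x. f x @ g x)"
proof -
  have "xs @ ys = foldr (\<lambda>y ys. y # ys) xs ys" for xs ys :: "'b list"
    by (induction xs) simp_all
  then have "(\<lambda>x. f x @ g x) = (\<lambda>x. foldr (\<lambda>y ys. y # ys) (f x) (g x))" by simp
  also have "computable \<dots>" by (intro computable_foldr computable_basic assms)
  finally show ?thesis .
qed

lemma computable_concat:
  assumes "computable f" shows "computable (\<lambda>x. concat (f x))"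
  unfolding concat_conv_foldr by (intro computable_foldr computable_append computable_basic assms)

lemma computable_map:
  assumes f: "computable (\<lambda>z. f (fst z) (snd z))" and l: "computable l"
  shows "computable (\<lambda>x. map (f x) (l x))"
proof -
  have "computable (\<lambda>z :: 'a \<times> 'b \<times> 'c list. f (fst z) (fst (snd z)))"
    using computable_comp[OF f, of _ "\<lambda>z. (fst z, fst (snd z))"] by (simp add: computable_basic)
  then have "computable (\<lambda>x. foldr (\<lambda>y ys. f x y # ys) (l x) [])"
    by (intro computable_foldr computable_basic l)
  moreover have "foldr (\<lambda>y ys. f x y # ys) ys [] = map (f x) ys" for x ys
    by (induction ys) auto
  ultimately show ?thesis by simp
qed

lemma computable_filter:
  assumes f: "computable (\<lambda>z. P (fst z) (snd z))" and l: "computable l"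
  shows "computable (\<lambda>x. filter (P x) (l x))"
proof -
  have "computable (\<lambda>z :: 'a \<times> 'b \<times> 'b list. P (fst z) (fst (snd z)))"
    using computable_comp[OF f, of _ "\<lambda>z. (fst z, fst (snd z))"] by (simp add: computable_basic)
  then have "computable (\<lambda>x. foldr (\<lambda>y ys. if P x y then y # ys else ys) (l x) [])"
    by (intro computable_foldr computable_basic l)
  moreover have "foldr (\<lambda>y ys. if P x y then y # ys else ys) ys [] = filter (P x) ys" for x ys
    by (induction ys) auto
  ultimately show ?thesis by simp
qed

lemma computable_Ball_set:
  assumes f: "computable (\<lambda>z. P (fst z) (snd z))" and l: "computable l"
  shows "computable (\<lambda>x. \<forall>y\<in>set (l x). P x y)"
proof -
  have "(\<lambda>x. \<forall>y\<in>set (l x). P x y) = (\<lambda>x. filter (\<lambda>y. \<not> P x y) (l x) = [])"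
    by (simp add: filter_empty_conv)
  also have "computable \<dots>" by (intro computable_eq computable_filter computable_not f l computable_const)
  finally show ?thesis .
qed

lemma computable_Bex_set:
  assumes f: "computable (\<lambda>z. P (fst z) (snd z))" and l: "computable l"
  shows "computable (\<lambda>x. \<exists>y\<in>set (l x). P x y)"
proof -
  have "(\<lambda>x. \<exists>y\<in>set (l x). P x y) = (\<lambda>x. filter (P x) (l x) \<noteq> [])"
    by (simp add: filter_empty_conv)
  also have "computable \<dots>"
    by (intro computable_not computable_eq computable_filter f l computable_const)
  finally show ?thesis .
qed

lemma computable_member:
  assumes "computable f" "computable l" shows "computable (\<lambda>x. f x \<in> set (l x))"
proof -
  have "(\<lambda>x. f x \<in> set (l x)) = (\<lambda>x. \<exists>y\<in>set (l x). y = f x)" by auto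
  also have "computable \<dots>"
    using computable_comp[OF assms(1) computable_fst[OF computable_id]]
    by (intro computable_Bex_set computable_eq computable_basic assms)
  finally show ?thesis .
qed

lemma computable_upt:
  assumes "computable n" shows "computable (\<lambda>x. [0..<n x])"
proof -
  define s :: "nat \<times> nat list \<Rightarrow> nat \<times> nat list" where "s z = (Suc (fst z), snd z @ [fst z])" for z
  have "(s ^^ k) (0, []) = (k, [0..<k])" for k
    by (induction k) (auto simp: s_def)
  then have "(\<lambda>x. [0..<n x]) = (\<lambda>x. snd ((s ^^ n x) (0, [])))" by simp
  also have "computable \<dots>"
    unfolding s_def by (intro computable_basic computable_append computable_funpow assms)
  finally show ?thesis .
qed

lemma computable_zip:
  assumes "computable f" "computable g" shows "computable (\<lambda>x. zip (f x) (g x))"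
proof -
  define s :: "('b \<times> 'c) list \<times> 'c list \<Rightarrow> 'b \<Rightarrow> ('b \<times> 'c) list \<times> 'c list" where
    "s z y = (case snd z of [] \<Rightarrow> z | c # cs \<Rightarrow> ((y, c) # fst z, cs))" for z y
  have "fst (foldl s (acc, ys) xs) = rev (zip xs ys) @ acc" for acc xs ys
    by (induction xs arbitrary: acc ys) (auto simp: s_def zip_Cons1 split: list.split)
  then have "(\<lambda>x. zip (f x) (g x)) = (\<lambda>x. rev (fst (foldl s ([], g x) (f x))))" by simp
  also have "computable \<dots>"
    unfolding s_def by (intro computable_rev computable_foldl computable_basic assms)
  finally show ?thesis .
qed

lemma computable_subseqs:
  assumes "computable l" shows "computable (\<lambda>x. subseqs (l x))"
proof -
  have "subseqs ys = foldr (\<lambda>y zss. map (\<lambda>zs. y # zs) zss @ zss) ys [[]]" for ys :: "'b list"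
    by (induction ys) (auto simp: Let_def)
  then have "(\<lambda>x. subseqs (l x)) =
      (\<lambda>x. foldr (\<lambda>y zss. map (\<lambda>zs. y # zs) zss @ zss) (l x) [[]])" by simp
  also have "computable \<dots>"
    by (intro computable_foldr computable_append computable_map computable_basic assms)
  finally show ?thesis .
qed

lemmas computable_intros = computable_basic computable_foldl computable_rev computable_foldr
  computable_append computable_concat computable_map computable_filter computable_Ball_set
  computable_Bex_set computable_member computable_upt computable_zip computable_subseqs

section \<open>General recursion\<close>

text \<open>A stack machine evaluates the recursion. A frame consists of an argument, the recursive calls
  still to be made, and the results obtained so far; the number of steps is found by minimization.\<close>

lemma computable_on_rec:
  fixes f :: "'a::enc \<Rightarrow> 'b::enc" and m :: "'a \<Rightarrow> nat"
  assumes calls: "computable calls" and G: "computable (\<lambda>z. G (fst z) (snd z))"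
    and f: "\<And>x. x \<in> D \<Longrightarrow> f x = G x (map f (calls x))"
    and dec: "\<And>x y. x \<in> D \<Longrightarrow> y \<in> set (calls x) \<Longrightarrow> y \<in> D \<and> m y < m x"
  shows "computable_on D f"
proof -
  define s :: "('a \<times> 'a list \<times> 'b list) \<times> ('a \<times> 'a list \<times> 'b list) list \<Rightarrow> _" where
    "s z = (case fst (snd (fst z)) of
        [] \<Rightarrow> (case snd z of
            [] \<Rightarrow> z
          | fr # st \<Rightarrow> ((fst fr, fst (snd fr), snd (snd fr) @ [G (fst (fst z)) (snd (snd (fst z)))]), st))
      | c # cs \<Rightarrow> ((c, calls c, []), (fst (fst z), cs, snd (snd (fst z))) # snd z))" for z
  have G': "computable (\<lambda>x. G (p x) (q x))" if "computable p" "computable q"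
    for p :: "'c::enc \<Rightarrow> 'a" and q
    using computable_comp[OF G computable_Pair[OF that]] by simp
  have s: "computable s"
    unfolding s_def by (intro computable_intros G' computable_comp[OF calls])
  \<comment> \<open>The stack below the current frame is arbitrary, so that the induction hypothesis
    covers a recursive call made on top of a suspended frame. The inner induction runs over the
    calls still pending.\<close>
  have run: "\<exists>n. (s ^^ n) ((x, calls x, []), st) = ((x, [], map f (calls x)), st)"
    if "x \<in> D" for x st
    using that
  proof (induction "m x" arbitrary: x st rule: less_induct)
    case less
    have "\<exists>n. (s ^^ n) ((x, cs, rs), st) = ((x, [], rs @ map f cs), st)"
      if "set cs \<subseteq> set (calls x)" for cs rs
      using that
    proof (induction cs arbitrary: rs)
      case Nil
      show ?case by (rule exI[of _ 0]) simp
    next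
      case (Cons c cs)
      have c: "c \<in> D" "m c < m x" using dec[OF less.prems] Cons.prems by auto
      obtain n where n: "(s ^^ n) ((c, calls c, []), (x, cs, rs) # st) =
          ((c, [], map f (calls c)), (x, cs, rs) # st)"
        using less.hyps[OF c(2,1)] by blast
      obtain k where k: "(s ^^ k) ((x, cs, rs @ [f c]), st) = ((x, [], (rs @ [f c]) @ map f cs), st)"
        using Cons.IH[of "rs @ [f c]"] Cons.prems by auto
      have "s ((x, c # cs, rs), st) = ((c, calls c, []), (x, cs, rs) # st)"
        by (simp add: s_def)
      moreover have "s ((c, [], map f (calls c)), (x, cs, rs) # st) = ((x, cs, rs @ [f c]), st)"
        by (simp add: s_def f[OF c(1)])
      ultimately have "(s ^^ k) (s ((s ^^ n) (s ((x, c # cs, rs), st)))) =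
          ((x, [], rs @ map f (c # cs)), st)"
        using n k by simp
      then have "(s ^^ (k + Suc (n + 1))) ((x, c # cs, rs), st) = ((x, [], rs @ map f (c # cs)), st)"
        by (simp add: funpow_add funpow_swap1)
      then show ?case by blast
    qed
    from this[of "calls x" "[]"] show ?case by simp
  qed
  define final where "final x n \<longleftrightarrow>
      fst (snd (fst ((s ^^ n) ((x, calls x, []), [])))) = [] \<and> snd ((s ^^ n) ((x, calls x, []), [])) = []" for x n
  have "computable (\<lambda>z. final (fst z) (snd z))"
    unfolding final_def by (intro computable_intros computable_funpow s computable_comp[OF calls])
  note L = computable_on_Least[OF this]
  have fin: "\<exists>n. final x n" if "x \<in> D" for x
  proof -
    obtain n where "(s ^^ n) ((x, calls x, []), []) = ((x, [], map f (calls x)), [])"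
      using run[OF \<open>x \<in> D\<close>] by blast
    then have "final x n" by (simp add: final_def)
    then show ?thesis ..
  qed
  have out: "(s ^^ n) ((x, calls x, []), []) = ((x, [], map f (calls x)), [])"
    if x: "x \<in> D" and n: "final x n" for x n
  proof -
    obtain k where k: "(s ^^ k) ((x, calls x, []), []) = ((x, [], map f (calls x)), [])"
      using run[OF x] by blast
    \<comment> \<open>Final states are fixed points. The state found by the search and the one given
      by \<open>run\<close> thus agree, both being the state after \<open>max n k\<close>
      steps.\<close>
    have stay: "(s ^^ j) z = z" if "fst (snd (fst z)) = []" "snd z = []" for j z
      using that by (induction j) (simp_all add: s_def)
    have split: "(s ^^ max n k) z = (s ^^ (max n k - j)) ((s ^^ j) z)" if "j \<le> max n k" for j z
      using that by (metis comp_apply funpow_add le_add_diff_inverse2)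
    have "(s ^^ max n k) ((x, calls x, []), []) = (s ^^ n) ((x, calls x, []), [])"
      by (subst split[of n], simp, rule stay) (use n in \<open>simp_all add: final_def\<close>)
    moreover have "(s ^^ max n k) ((x, calls x, []), []) = (s ^^ k) ((x, calls x, []), [])"
      by (subst split[of k], simp, rule stay) (use k in simp_all)
    ultimately show ?thesis using k by simp
  qed
  \<comment> \<open>Only the search is partial. Reading off the result from the argument and the
    step count is a total computable function.\<close>
  have "computable_on D (\<lambda>x. (x, LEAST n. final x n))"
    by (intro computable_Pair computable_id computable_on_subset[OF L]) (use fin in auto)
  moreover have "computable (\<lambda>z. G (fst z) (snd (snd (fst ((s ^^ snd z) ((fst z, calls (fst z), []), []))))))"
    by (intro G' computable_intros computable_funpow s computable_comp[OF calls])
  ultimately have "computable_on D (\<lambda>x. G x (snd (snd (fst ((s ^^ (LEAST n. final x n)) ((x, calls x, []), []))))))"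
    using computable_comp by fastforce
  moreover have "G x (snd (snd (fst ((s ^^ (LEAST n. final x n)) ((x, calls x, []), []))))) = f x"
    if "x \<in> D" for x
    using out[OF that LeastI_ex[OF fin[OF that]]] f[OF that] by simp
  ultimately show ?thesis
    by (auto elim!: computable_same_code)
qed

section \<open>Computable operations on formulas\<close>

lemma enc_trm_list: "enc ts = list_encode (map trm_code ts)"
  by (simp add: enc_list_def)

lemma enc_fm_list: "enc Gs = list_encode (map fm_code Gs)"
  by (simp add: enc_list_def)

lemma computable_list_decode: "computable_on D f \<Longrightarrow> computable_on D (\<lambda>x. list_decode (f x))"
  by (erule computable_same_code) (simp add: enc_list_def enc_nat_def[abs_def])

lemma computable_Var: "computable_on D f \<Longrightarrow> computable_on D (\<lambda>x. Var (f x))"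
  by (rule computable_same_code[where f = "\<lambda>x. (0::nat, f x)"])
    (intro computable_Pair computable_const, assumption, simp)

lemma computable_Const: "computable_on D f \<Longrightarrow> computable_on D (\<lambda>x. Const (f x))"
  by (rule computable_same_code[where f = "\<lambda>x. (1::nat, f x)"])
    (intro computable_Pair computable_const, assumption, simp)

lemma computable_Atom:
  "computable_on D p \<Longrightarrow> computable_on D f \<Longrightarrow> computable_on D (\<lambda>x. Atom (p x) (f x))"
  by (rule computable_same_code[where f = "\<lambda>x. (0::nat, p x, f x)"])
    (intro computable_Pair computable_const, assumption+, simp add: enc_trm_list)

lemma computable_Neg: "computable_on D f \<Longrightarrow> computable_on D (\<lambda>x. Neg (f x))"
  by (rule computable_same_code[where f = "\<lambda>x. (3::nat, f x)"])
    (intro computable_Pair computable_const, assumption, simp)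

lemma computable_Conj: "computable_on D f \<Longrightarrow> computable_on D (\<lambda>x. Conj (f x))"
  by (rule computable_same_code[where f = "\<lambda>x. (4::nat, f x)"])
    (intro computable_Pair computable_const, assumption, simp add: enc_fm_list)

lemma computable_Disj: "computable_on D f \<Longrightarrow> computable_on D (\<lambda>x. Disj (f x))"
  by (rule computable_same_code[where f = "\<lambda>x. (5::nat, f x)"])
    (intro computable_Pair computable_const, assumption, simp add: enc_fm_list)

lemma computable_Imp:
  "computable_on D f \<Longrightarrow> computable_on D g \<Longrightarrow> computable_on D (\<lambda>x. Imp (f x) (g x))"
  by (rule computable_same_code[where f = "\<lambda>x. (6::nat, f x, g x)"])
    (intro computable_Pair computable_const, assumption+, simp)

lemma computable_ChAnd: "computable_on D f \<Longrightarrow> computable_on D (\<lambda>x. ChAnd (f x))"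
  by (rule computable_same_code[where f = "\<lambda>x. (7::nat, f x)"])
    (intro computable_Pair computable_const, assumption, simp add: enc_fm_list)

lemma computable_ChOr: "computable_on D f \<Longrightarrow> computable_on D (\<lambda>x. ChOr (f x))"
  by (rule computable_same_code[where f = "\<lambda>x. (8::nat, f x)"])
    (intro computable_Pair computable_const, assumption, simp add: enc_fm_list)

lemma computable_Forall:
  "computable_on D f \<Longrightarrow> computable_on D g \<Longrightarrow> computable_on D (\<lambda>x. Forall (f x) (g x))"
  by (rule computable_same_code[where f = "\<lambda>x. (9::nat, f x, g x)"])
    (intro computable_Pair computable_const, assumption+, simp)

lemma computable_Exists:
  "computable_on D f \<Longrightarrow> computable_on D g \<Longrightarrow> computable_on D (\<lambda>x. Exists (f x) (g x))"
  by (rule computable_same_code[where f = "\<lambda>x. (10::nat, f x, g x)"])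
    (intro computable_Pair computable_const, assumption+, simp)

lemma computable_ChAll:
  "computable_on D f \<Longrightarrow> computable_on D g \<Longrightarrow> computable_on D (\<lambda>x. ChAll (f x) (g x))"
  by (rule computable_same_code[where f = "\<lambda>x. (11::nat, f x, g x)"])
    (intro computable_Pair computable_const, assumption+, simp)

lemma computable_ChEx:
  "computable_on D f \<Longrightarrow> computable_on D g \<Longrightarrow> computable_on D (\<lambda>x. ChEx (f x) (g x))"
  by (rule computable_same_code[where f = "\<lambda>x. (12::nat, f x, g x)"])
    (intro computable_Pair computable_const, assumption+, simp)

text \<open>A uniform view of formulas as trees: the label of a node holds the constructor tag used by
  \<open>fm_code\<close>, the predicate letter or quantified variable, and the terms of an atom.\<close>

type_synonym label = "nat \<times> nat \<times> trm list"

fun label :: "fm \<Rightarrow> label" where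
  "label (Atom p ts) = (0, p, ts)"
| "label Top = (1, 0, [])"
| "label Bot = (2, 0, [])"
| "label (Neg G) = (3, 0, [])"
| "label (Conj Gs) = (4, 0, [])"
| "label (Disj Gs) = (5, 0, [])"
| "label (Imp G H) = (6, 0, [])"
| "label (ChAnd Gs) = (7, 0, [])"
| "label (ChOr Gs) = (8, 0, [])"
| "label (Forall x G) = (9, x, [])"
| "label (Exists x G) = (10, x, [])"
| "label (ChAll x G) = (11, x, [])"
| "label (ChEx x G) = (12, x, [])"

fun kids :: "fm \<Rightarrow> fm list" where
  "kids (Neg G) = [G]"
| "kids (Conj Gs) = Gs"
| "kids (Disj Gs) = Gs"
| "kids (Imp G H) = [G, H]"
| "kids (ChAnd Gs) = Gs"
| "kids (ChOr Gs) = Gs"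
| "kids (Forall x G) = [G]"
| "kids (Exists x G) = [G]"
| "kids (ChAll x G) = [G]"
| "kids (ChEx x G) = [G]"
| "kids _ = []"

text \<open>The results \<open>Top\<close> for child lists that are too short are defaults making
  the function total. Tag 6 is the case that falls through to \<open>Imp\<close>.\<close>

definition node :: "label \<Rightarrow> fm list \<Rightarrow> fm" where
  "node l Ks = (case l of (k, x, ts) \<Rightarrow>
     if k = 0 then Atom x ts else if k = 1 then Top else if k = 2 then Bot
     else if k = 4 then Conj Ks else if k = 5 then Disj Ks
     else if k = 7 then ChAnd Ks else if k = 8 then ChOr Ks
     else case Ks of [] \<Rightarrow> Top
     | G # Hs \<Rightarrow>
         if k = 3 then Neg G else if k = 9 then Forall x G else if k = 10 then Exists x G
         else if k = 11 then ChAll x G else if k = 12 then ChEx x G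
         else case Hs of [] \<Rightarrow> Top | H # _ \<Rightarrow> Imp G H)"

lemma size_kids: "K \<in> set (kids F) \<Longrightarrow> size K < size F"
  by (cases F) (auto simp: less_Suc_eq_le intro!: size_list_estimation')

lemma computable_label: "computable f \<Longrightarrow> computable (\<lambda>x. label (f x))"
proof (erule computable_comp[rotated], rule computable_recode)
  \<comment> \<open>The last component stands for the code of a term list, and 0 is the code of
    \<open>[]\<close>. Among the tags of formulas, those from 9 on belong to the four
    quantifiers.\<close>
  let ?g = "\<lambda>n :: nat. case prod_decode n of (k, c) \<Rightarrow>
    if k = 0 then (k, prod_decode c)
    else if 9 \<le> k then (k, fst (prod_decode c), 0) else (k, 0 :: nat, 0 :: nat)"
  show "computable ?g" by (intro computable_intros)
  show "enc (label F) = enc (?g (enc F))" for F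
    by (cases F) (simp_all add: enc_trm_list)
qed

lemma computable_kids: "computable f \<Longrightarrow> computable (\<lambda>x. kids (f x))"
proof (erule computable_comp[rotated], rule computable_recode)
  let ?g = "\<lambda>n. case prod_decode n of (k, c) \<Rightarrow>
    if k = 3 then [c] else if k = 6 then [fst (prod_decode c), snd (prod_decode c)]
    else if 9 \<le> k then [snd (prod_decode c)]
    else if k = 4 \<or> k = 5 \<or> k = 7 \<or> k = 8 then list_decode c else []"
  show "computable ?g" by (intro computable_intros computable_list_decode)
  show "enc (kids F) = enc (?g (enc F))" for F
    by (cases F) (simp_all add: enc_list_def comp_def)
qed

lemma computable_node: "computable l \<Longrightarrow> computable Ks \<Longrightarrow> computable (\<lambda>x. node (l x) (Ks x))"
proof -
  assume "computable l" "computable Ks"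
  moreover have "computable (\<lambda>z. node (fst z) (snd z))"
    unfolding node_def
    by (intro computable_intros computable_Atom computable_Neg computable_Conj computable_Disj
        computable_Imp computable_ChAnd computable_ChOr computable_Forall computable_Exists
        computable_ChAll computable_ChEx)
  ultimately show ?thesis using computable_comp[OF _ computable_Pair] by fastforce
qed

lemmas computable_fm_intros =
  computable_intros computable_Var computable_Const computable_Atom
  computable_label computable_kids computable_node

text \<open>Structural recursion as an instance of general recursion: the calls go to the children
  with the parameter unchanged, and formula size decreases.\<close>

lemma computable_fm_rec:
  fixes f :: "'p::enc \<Rightarrow> fm \<Rightarrow> 'b::enc"
  assumes f: "\<And>p F. f p F = G p F (map (f p) (kids F))"
    and G: "computable (\<lambda>z. G (fst (fst z)) (snd (fst z)) (snd z))"
    and "computable p" "computable F"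
  shows "computable (\<lambda>x. f (p x) (F x))"
proof -
  have "computable (\<lambda>z. f (fst z) (snd z))"
  proof (rule computable_on_rec[where m = "\<lambda>z. size (snd z)"
        and calls = "\<lambda>z. map (\<lambda>K. (fst z, K)) (kids (snd z))"
        and G = "\<lambda>z. G (fst z) (snd z)"])
    show "computable (\<lambda>z :: 'p \<times> fm. map (\<lambda>K. (fst z, K)) (kids (snd z)))"
      by (intro computable_fm_intros)
    show "computable (\<lambda>z. G (fst (fst z)) (snd (fst z)) (snd z))" by (rule G)
    show "f (fst z) (snd z) = G (fst z) (snd z)
        (map (\<lambda>z. f (fst z) (snd z)) (map (\<lambda>K. (fst z, K)) (kids (snd z))))" for z :: "'p \<times> fm"
      by (subst f) (simp add: comp_def)
  qed (auto intro: size_kids)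
  from computable_comp[OF this computable_Pair[OF assms(3,4)]] show ?thesis by simp
qed

lemma computable_subst:
  assumes "computable x" "computable t" "computable F"
  shows "computable (\<lambda>z. subst (x z) (t z) (F z))"
proof -
  define G where "G p F rs = (case label F of (k, y, ts) \<Rightarrow>
      if k = 0 then Atom y (map (\<lambda>s. if s = Var (fst p) then snd p else s) ts)
      else if 9 \<le> k \<and> y = fst p then F
      else node (label F) rs)" for p :: "nat \<times> trm" and F rs
  have "computable (\<lambda>z. subst (fst (x z, t z)) (snd (x z, t z)) (F z))"
  proof (rule computable_fm_rec[where G = G and f = "\<lambda>p. subst (fst p) (snd p)"
        and p = "\<lambda>z. (x z, t z)"])
    show "subst (fst p) (snd p) F = G p F (map (subst (fst p) (snd p)) (kids F))" for p F
      by (cases F) (simp_all add: G_def node_def)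
    show "computable (\<lambda>z. G (fst (fst z)) (snd (fst z)) (snd z))"
      unfolding G_def by (intro computable_fm_intros)
  qed (intro computable_Pair computable_const assms)+
  then show ?thesis by simp
qed

lemma computable_free_vars:
  assumes "computable x" "computable F"
  shows "computable (\<lambda>z. x z \<in> free_vars (F z))"
proof -
  define G where "G x F rs = (case label F of (k, y, ts) \<Rightarrow>
      if k = 0 then Var x \<in> set ts else (9 \<le> k \<longrightarrow> y \<noteq> x) \<and> (\<exists>b\<in>set rs. b))" for x :: nat and F rs
  have "computable (\<lambda>z. x z \<in> free_vars (F z))"
  proof (rule computable_fm_rec[where G = G and f = "\<lambda>x F. x \<in> free_vars F"
        and p = x])
    show "x \<in> free_vars F \<longleftrightarrow> G x F (map (\<lambda>F. x \<in> free_vars F) (kids F))" for x F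
      by (cases F) (auto simp: G_def)
    show "computable (\<lambda>z. G (fst (fst z)) (snd (fst z)) (snd z))"
      unfolding G_def by (intro computable_fm_intros)
  qed (intro computable_Pair computable_const assms)+
  then show ?thesis by simp
qed

lemma computable_free_for:
  assumes "computable x" "computable y" "computable F"
  shows "computable (\<lambda>z. free_for (x z) (y z) (F z))"
proof -
  define G where "G p F rs = (case label F of (k, z, ts) \<Rightarrow>
      9 \<le> k \<and> z = fst p \<or>
      (9 \<le> k \<and> z = snd p \<longrightarrow> (\<forall>K\<in>set (kids F). \<not> fst p \<in> free_vars K)) \<and> (\<forall>b\<in>set rs. b))"
    for p :: "nat \<times> nat" and F rs
  have "computable (\<lambda>z. free_for (fst (x z, y z)) (snd (x z, y z)) (F z))"
  proof (rule computable_fm_rec[where G = G and f = "\<lambda>p. free_for (fst p) (snd p)"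
        and p = "\<lambda>z. (x z, y z)"])
    show "free_for (fst p) (snd p) F = G p F (map (free_for (fst p) (snd p)) (kids F))" for p F
      by (cases F) (auto simp: G_def)
    show "computable (\<lambda>z. G (fst (fst z)) (snd (fst z)) (snd z))"
      unfolding G_def by (intro computable_fm_intros computable_free_vars)
  qed (intro computable_Pair computable_const assms)+
  then show ?thesis by simp
qed

section \<open>Propositional evaluation of elementarizations\<close>

fun atoms :: "fm \<Rightarrow> fm list" where
  "atoms (Atom p ts) = [Atom p ts]"
| "atoms (Neg G) = atoms G"
| "atoms (Conj Gs) = concat (map (\<lambda>G. atoms G) Gs)"
| "atoms (Disj Gs) = concat (map (\<lambda>G. atoms G) Gs)"
| "atoms (Imp G H) = atoms G @ atoms H"
| "atoms (ChAnd Gs) = concat (map (\<lambda>G. atoms G) Gs)"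
| "atoms (ChOr Gs) = concat (map (\<lambda>G. atoms G) Gs)"
| "atoms (Forall x G) = atoms G"
| "atoms (Exists x G) = atoms G"
| "atoms (ChAll x G) = atoms G"
| "atoms (ChEx x G) = atoms G"
| "atoms _ = []"

text \<open>Propositional value of the elementarization, where \<open>S\<close> lists the true atoms. Blind quantifiers
  get a dummy value.\<close>

fun peval :: "fm list \<Rightarrow> fm \<Rightarrow> bool" where
  "peval S (Atom p ts) = (Atom p ts \<in> set S)"
| "peval S Top = True"
| "peval S Bot = False"
| "peval S (Neg G) = (\<not> peval S G)"
| "peval S (Conj Gs) = (\<forall>G\<in>set Gs. peval S G)"
| "peval S (Disj Gs) = (\<exists>G\<in>set Gs. peval S G)"
| "peval S (Imp G H) = (peval S G \<longrightarrow> peval S H)"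
| "peval S (ChAnd Gs) = True"
| "peval S (ChOr Gs) = False"
| "peval S (Forall x G) = False"
| "peval S (Exists x G) = False"
| "peval S (ChAll x G) = True"
| "peval S (ChEx x G) = False"

lemma computable_atoms:
  assumes "computable F" shows "computable (\<lambda>z. atoms (F z))"
proof -
  define G where "G p F rs = (case label F of (k, _) \<Rightarrow> if k = 0 then [F] else concat rs)" for p :: nat and F rs
  have "computable (\<lambda>z. atoms (F z))"
  proof (rule computable_fm_rec[where G = G and f = "\<lambda>_ :: nat. atoms"
        and p = "\<lambda>z. 0"])
    show "atoms F = G p F (map atoms (kids F))" for p F
      by (cases F) (simp_all add: G_def)
    show "computable (\<lambda>z. G (fst (fst z)) (snd (fst z)) (snd z))"
      unfolding G_def by (intro computable_fm_intros)
  qed (intro computable_Pair computable_const assms)+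
  then show ?thesis by simp
qed

lemma computable_peval:
  assumes "computable S" "computable F" shows "computable (\<lambda>z. peval (S z) (F z))"
proof -
  \<comment> \<open>A negation has one child and an implication two, so the universal tests over
    \<open>rs\<close> (tag 3) and \<open>bs\<close> (tag 6) just read off a single value.\<close>
  define G where "G S F rs = (case label F of (k, _) \<Rightarrow>
      if k = 0 then F \<in> set S else if k = 1 \<or> k = 7 \<or> k = 11 then True
      else if k = 3 then \<not> (\<forall>b\<in>set rs. b)
      else if k = 4 then \<forall>b\<in>set rs. b
      else if k = 5 then \<exists>b\<in>set rs. b
      else if k = 6 then case rs of [] \<Rightarrow> True | b # bs \<Rightarrow> b \<longrightarrow> (\<forall>c\<in>set bs. c)
      else False)" for S F rs
  have "computable (\<lambda>z. peval (S z) (F z))"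
  proof (rule computable_fm_rec[where G = G and f = peval
        and p = S])
    show "peval p F = G p F (map (peval p) (kids F))" for p F
      by (cases F) (simp_all add: G_def)
    show "computable (\<lambda>z. G (fst (fst z)) (snd (fst z)) (snd z))"
      unfolding G_def by (intro computable_fm_intros)
  qed (intro computable_Pair computable_const assms)+
  then show ?thesis by simp
qed

section \<open>Enumeration of candidate premises\<close>

text \<open>Given the components of a formula, each with its list of possible replacements, \<open>replace_one\<close>
  lists all ways to replace exactly one component.\<close>

fun replace_one :: "(fm \<times> (bool \<times> bool \<times> fm) list) list \<Rightarrow> (bool \<times> bool \<times> fm list) list" where
  "replace_one [] = []"
| "replace_one ((G, ms) # ps) =
     map (\<lambda>(q, a, H). (q, a, H # map fst ps)) ms @
     map (\<lambda>(q, a, Hs). (q, a, G # Hs)) (replace_one ps)"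

lemma computable_replace_one:
  assumes "computable f" shows "computable (\<lambda>x. replace_one (f x))"
proof -
  let ?s = "\<lambda>(p :: fm \<times> (bool \<times> bool \<times> fm) list) (z :: fm list \<times> (bool \<times> bool \<times> fm list) list).
    (fst p # fst z, map (\<lambda>(q, a, H). (q, a, H # fst z)) (snd p) @
       map (\<lambda>(q, a, Hs). (q, a, fst p # Hs)) (snd z))"
  have "foldr ?s ps ([], []) = (map fst ps, replace_one ps)" for ps
    by (induction ps rule: replace_one.induct) auto
  then have "(\<lambda>x. replace_one (f x)) = (\<lambda>x. snd (foldr ?s (f x) ([], [])))" by simp
  also have "computable \<dots>" by (intro computable_intros assms)
  finally show ?thesis .
qed

text \<open>The bound \<open>N\<close> itself is included, as the representative of the terms
  foreign to the formula. Constants cannot be captured, so only variables are filtered. Quantifiers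
  around the occurrence are not checked: without blind quantifiers there are none at the
  surface.\<close>

definition witnesses :: "nat \<Rightarrow> nat \<Rightarrow> fm \<Rightarrow> trm list" where
  "witnesses N x G = map Const [0..<Suc N] @ map Var (filter (\<lambda>y. free_for x y G) [0..<Suc N])"

text \<open>The entry \<open>(q, a, H)\<close> of \<open>moves N F\<close> means that \<open>H\<close> results from \<open>F\<close> by replacing one surface
  occurrence of a choice subformula, as in rule A if \<open>a\<close> and as in rule B otherwise, provided that
  \<open>F\<close> itself is considered as a positive occurrence if \<open>q\<close> and as a negative one otherwise.\<close>

fun moves :: "nat \<Rightarrow> fm \<Rightarrow> (bool \<times> bool \<times> fm) list" where
  "moves N (Atom p ts) = []"
| "moves N Top = []"
| "moves N Bot = []"
| "moves N (Neg G) = map (\<lambda>(q, a, H). (\<not> q, a, Neg H)) (moves N G)"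
| "moves N (Conj Gs) =
     map (\<lambda>(q, a, Hs). (q, a, Conj Hs)) (replace_one (map (\<lambda>G. (G, moves N G)) Gs))"
| "moves N (Disj Gs) =
     map (\<lambda>(q, a, Hs). (q, a, Disj Hs)) (replace_one (map (\<lambda>G. (G, moves N G)) Gs))"
| "moves N (Imp G H) =
     map (\<lambda>(q, a, G'). (\<not> q, a, Imp G' H)) (moves N G) @
     map (\<lambda>(q, a, H'). (q, a, Imp G H')) (moves N H)"
| "moves N (ChAnd Gs) = map (\<lambda>G. (True, True, G)) Gs @ map (\<lambda>G. (False, False, G)) Gs"
| "moves N (ChOr Gs) = map (\<lambda>G. (False, True, G)) Gs @ map (\<lambda>G. (True, False, G)) Gs"
| "moves N (Forall x G) = map (\<lambda>(q, a, H). (q, a, Forall x H)) (moves N G)"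
| "moves N (Exists x G) = map (\<lambda>(q, a, H). (q, a, Exists x H)) (moves N G)"
| "moves N (ChAll x G) =
     (True, True, subst x (Var N) G) # map (\<lambda>t. (False, False, subst x t G)) (witnesses N x G)"
| "moves N (ChEx x G) =
     (False, True, subst x (Var N) G) # map (\<lambda>t. (True, False, subst x t G)) (witnesses N x G)"

lemma computable_moves:
  assumes "computable N" "computable F" shows "computable (\<lambda>z. moves (N z) (F z))"
proof -
  \<comment> \<open>Of the components of a negation or an implication exactly the first has reversed
    polarity, so only the head of \<open>rs\<close> gets its flags flipped.\<close>
  define G where "G N F rs = (case label F of (k, x, _) \<Rightarrow>
      if k = 7 \<or> k = 8 then
        map (\<lambda>G. (k = 7, True, G)) (kids F) @ map (\<lambda>G. (k = 8, False, G)) (kids F)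
      else if 11 \<le> k then
        case kids F of [] \<Rightarrow> [] | G # _ \<Rightarrow>
          (k = 11, True, subst x (Var N) G) #
          map (\<lambda>t. (k = 12, False, subst x t G)) (witnesses N x G)
      else
        map (\<lambda>(q, a, Hs). (q, a, node (label F) Hs)) (replace_one (zip (kids F)
          (if k = 3 \<or> k = 6 then case rs of [] \<Rightarrow> [] | m # ms \<Rightarrow> map (\<lambda>(q, r). (\<not> q, r)) m # ms
           else rs))))" for N F rs
  have "computable (\<lambda>z. moves (N z) (F z))"
  proof (rule computable_fm_rec[where G = G and f = moves
        and p = N])
    show "moves p F = G p F (map (moves p) (kids F))" for p F
      by (cases F) (simp_all add: G_def node_def split_def comp_def zip_map2 zip_same_conv_map)
    show "computable (\<lambda>z. G (fst (fst z)) (snd (fst z)) (snd z))"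
      unfolding witnesses_def G_def by (intro computable_fm_intros computable_subst computable_free_for
          computable_replace_one)
  qed (intro computable_Pair computable_const assms)+
  then show ?thesis by simp
qed

section \<open>Stability of formulas without blind quantifiers\<close>

lemma atoms_Atom: "A \<in> set (atoms F) \<Longrightarrow> \<exists>p ts. A = Atom p ts"
  by (induction F) auto

text \<open>Choice quantifiers have become constants and blind ones are absent, so the
  elementarization is quantifier-free. The valuation never changes, and only the truth values of
  atoms matter.\<close>

lemma sat_elementarization_peval:
  "blind_free F \<Longrightarrow> \<forall>A\<in>set (atoms F). sat D P c e A \<longleftrightarrow> A \<in> set S \<Longrightarrow>
    sat D P c e (elementarization F) \<longleftrightarrow> peval S F"
  by (induction F) (simp_all add: ball_Un cong: ball_cong bex_cong)

text \<open>Without equality and function symbols, distinct atoms are independent: each set of atoms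
  is the set of true ones in some structure. The sublists of \<open>atoms F\<close> cover all these
  sets.\<close>

lemma stable_iff_peval:
  assumes F: "blind_free F"
  shows "stable F \<longleftrightarrow> (\<forall>S\<in>set (subseqs (atoms F)). peval S F)"
proof (intro iffI ballI)
  fix S assume "stable F" and "S \<in> set (subseqs (atoms F))"
  \<comment> \<open>A term model: each term denotes its own code, and injectivity of
    \<open>trm_code\<close> keeps distinct atoms apart.\<close>
  let ?P = "\<lambda>p ds. \<exists>ts. ds = map trm_code ts \<and> Atom p ts \<in> set S"
  let ?c = "\<lambda>k. trm_code (Const k)" and ?e = "\<lambda>x. trm_code (Var x)"
  have val: "trm_val ?c ?e = trm_code"
  proof
    show "trm_val ?c ?e t = trm_code t" for t by (cases t) simp_all
  qed
  have "sat UNIV ?P ?c ?e A \<longleftrightarrow> A \<in> set S" if A: "A \<in> set (atoms F)" for A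
  proof -
    obtain p ts where "A = Atom p ts" using atoms_Atom[OF A] by blast
    then show ?thesis
      by (simp only: sat.simps val) (auto simp: map_eq_map_iff trm_code_eq_iff)
  qed
  then have "sat UNIV ?P ?c ?e (elementarization F) \<longleftrightarrow> peval S F"
    by (intro sat_elementarization_peval[OF F] ballI)
  then show "peval S F" using \<open>stable F\<close> unfolding stable_def valid_def by blast
next
  assume *: "\<forall>S\<in>set (subseqs (atoms F)). peval S F"
  have "sat D P c e (elementarization F)" for D :: "nat set" and P c e
  proof -
    have "{A\<in>set (atoms F). sat D P c e A} \<in> set ` set (subseqs (atoms F))"
      by (auto simp: subseqs_powset)
    then obtain S where S: "S \<in> set (subseqs (atoms F))" "set S = {A\<in>set (atoms F). sat D P c e A}"
      by auto
    then have "sat D P c e (elementarization F) \<longleftrightarrow> peval S F"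
      by (intro sat_elementarization_peval[OF F]) simp
    with * S show ?thesis by simp
  qed
  then show "stable F" by (simp add: stable_def valid_def)
qed

section \<open>Invariance of CL2 under renaming\<close>

text \<open>Renaming acts on all variables, bound ones included, so it commutes with substitution and
  never captures.\<close>

fun rename_trm :: "(nat \<Rightarrow> nat) \<Rightarrow> (nat \<Rightarrow> nat) \<Rightarrow> trm \<Rightarrow> trm" where
  "rename_trm \<pi> \<rho> (Var x) = Var (\<pi> x)"
| "rename_trm \<pi> \<rho> (Const k) = Const (\<rho> k)"

primrec rename :: "(nat \<Rightarrow> nat) \<Rightarrow> (nat \<Rightarrow> nat) \<Rightarrow> fm \<Rightarrow> fm" where
  "rename \<pi> \<rho> (Atom p ts) = Atom p (map (rename_trm \<pi> \<rho>) ts)"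
| "rename \<pi> \<rho> Top = Top"
| "rename \<pi> \<rho> Bot = Bot"
| "rename \<pi> \<rho> (Neg G) = Neg (rename \<pi> \<rho> G)"
| "rename \<pi> \<rho> (Conj Gs) = Conj (map (rename \<pi> \<rho>) Gs)"
| "rename \<pi> \<rho> (Disj Gs) = Disj (map (rename \<pi> \<rho>) Gs)"
| "rename \<pi> \<rho> (Imp G H) = Imp (rename \<pi> \<rho> G) (rename \<pi> \<rho> H)"
| "rename \<pi> \<rho> (ChAnd Gs) = ChAnd (map (rename \<pi> \<rho>) Gs)"
| "rename \<pi> \<rho> (ChOr Gs) = ChOr (map (rename \<pi> \<rho>) Gs)"
| "rename \<pi> \<rho> (Forall x G) = Forall (\<pi> x) (rename \<pi> \<rho> G)"
| "rename \<pi> \<rho> (Exists x G) = Exists (\<pi> x) (rename \<pi> \<rho> G)"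
| "rename \<pi> \<rho> (ChAll x G) = ChAll (\<pi> x) (rename \<pi> \<rho> G)"
| "rename \<pi> \<rho> (ChEx x G) = ChEx (\<pi> x) (rename \<pi> \<rho> G)"

primrec rename_sctx :: "(nat \<Rightarrow> nat) \<Rightarrow> (nat \<Rightarrow> nat) \<Rightarrow> sctx \<Rightarrow> sctx" where
  "rename_sctx \<pi> \<rho> Hole = Hole"
| "rename_sctx \<pi> \<rho> (CNeg C) = CNeg (rename_sctx \<pi> \<rho> C)"
| "rename_sctx \<pi> \<rho> (CConj Gs C Hs) =
     CConj (map (rename \<pi> \<rho>) Gs) (rename_sctx \<pi> \<rho> C) (map (rename \<pi> \<rho>) Hs)"
| "rename_sctx \<pi> \<rho> (CDisj Gs C Hs) =
     CDisj (map (rename \<pi> \<rho>) Gs) (rename_sctx \<pi> \<rho> C) (map (rename \<pi> \<rho>) Hs)"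
| "rename_sctx \<pi> \<rho> (CImpL C H) = CImpL (rename_sctx \<pi> \<rho> C) (rename \<pi> \<rho> H)"
| "rename_sctx \<pi> \<rho> (CImpR G C) = CImpR (rename \<pi> \<rho> G) (rename_sctx \<pi> \<rho> C)"
| "rename_sctx \<pi> \<rho> (CForall x C) = CForall (\<pi> x) (rename_sctx \<pi> \<rho> C)"
| "rename_sctx \<pi> \<rho> (CExists x C) = CExists (\<pi> x) (rename_sctx \<pi> \<rho> C)"

lemma rename_fill: "rename \<pi> \<rho> (fill C E) = fill (rename_sctx \<pi> \<rho> C) (rename \<pi> \<rho> E)"
  by (induction C) auto

lemma positive_rename_sctx [simp]: "positive (rename_sctx \<pi> \<rho> C) = positive C"
  by (induction C) auto

lemma binders_rename_sctx: "binders (rename_sctx \<pi> \<rho> C) = \<pi> ` binders C"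
  by (induction C) auto

lemma wff_rename [simp]: "wff (rename \<pi> \<rho> F) = wff F"
  by (induction F) auto

lemma elementarization_rename:
  "elementarization (rename \<pi> \<rho> F) = rename \<pi> \<rho> (elementarization F)"
  by (induction F) auto

lemma mem_vars_rename_trm: "Var x = rename_trm \<pi> \<rho> t \<longleftrightarrow> (\<exists>y. t = Var y \<and> x = \<pi> y)"
  by (cases t) auto

lemma vars_rename: "vars (rename \<pi> \<rho> F) = \<pi> ` vars F"
proof (induction F)
  case (Atom p ts)
  then show ?case by (auto simp: image_iff mem_vars_rename_trm)
qed (simp_all add: image_UN image_Un)

text \<open>Renaming preserves the shape of a context, so the holes on both sides are at the same
  position and the two sides can be compared piece by piece.\<close>

lemma rename_fill_fixed:
  "fill (rename_sctx \<pi> \<rho> C) (rename \<pi> \<rho> E) = fill C E \<Longrightarrow>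
    rename_sctx \<pi> \<rho> C = C \<and> rename \<pi> \<rho> E = E"
  by (induction C) auto

text \<open>Swaps are the only renamings applied later. Since such a map is its own inverse,
  decompositions of a renamed formula are pulled back by the same map.\<close>

locale involutive_renaming =
  fixes \<pi> \<rho> :: "nat \<Rightarrow> nat"
  assumes \<pi>_\<pi> [simp]: "\<pi> (\<pi> x) = x" and \<rho>_\<rho> [simp]: "\<rho> (\<rho> k) = k"
begin

lemma \<pi>_eq_iff [simp]: "\<pi> x = \<pi> y \<longleftrightarrow> x = y"
  by (metis \<pi>_\<pi>)

lemma rename_trm_involutive [simp]: "rename_trm \<pi> \<rho> (rename_trm \<pi> \<rho> t) = t"
  by (cases t) auto

lemma rename_trm_eq_Var [simp]: "rename_trm \<pi> \<rho> t = Var (\<pi> x) \<longleftrightarrow> t = Var x"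
  by (cases t) auto

lemma rename_involutive [simp]: "rename \<pi> \<rho> (rename \<pi> \<rho> F) = F"
  by (induction F) (auto simp: map_idI)

lemma rename_sctx_involutive [simp]: "rename_sctx \<pi> \<rho> (rename_sctx \<pi> \<rho> C) = C"
  by (induction C) (auto simp: map_idI)

lemma rename_eq_fill_iff:
  "rename \<pi> \<rho> F = fill C E \<longleftrightarrow> F = fill (rename_sctx \<pi> \<rho> C) (rename \<pi> \<rho> E)"
  by (metis rename_fill rename_involutive rename_sctx_involutive)

lemma rename_subst:
  "rename \<pi> \<rho> (subst x t F) = subst (\<pi> x) (rename_trm \<pi> \<rho> t) (rename \<pi> \<rho> F)"
  by (induction F) auto

lemma free_vars_rename: "\<pi> x \<in> free_vars (rename \<pi> \<rho> F) \<longleftrightarrow> x \<in> free_vars F"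
  by (induction F) (auto simp: image_iff mem_vars_rename_trm)

lemma free_for_rename: "free_for (\<pi> x) (\<pi> y) (rename \<pi> \<rho> F) \<longleftrightarrow> free_for x y F"
  by (induction F) (auto simp: free_vars_rename)

lemma sat_rename:
  "sat D P c e (rename \<pi> \<rho> F) \<longleftrightarrow> sat D P (\<lambda>k. c (\<rho> k)) (\<lambda>x. e (\<pi> x)) F"
proof (induction F arbitrary: e)
  case (Atom p ts)
  have "trm_val c e (rename_trm \<pi> \<rho> t) = trm_val (\<lambda>k. c (\<rho> k)) (\<lambda>x. e (\<pi> x)) t" for t
    by (cases t) auto
  then show ?case by (simp add: comp_def)
next
  case (Forall x F)
  have "(\<lambda>z. (e(\<pi> x := d)) (\<pi> z)) = (\<lambda>z. e (\<pi> z))(x := d)" for d by auto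
  with Forall show ?case by simp
next
  case (Exists x F)
  have "(\<lambda>z. (e(\<pi> x := d)) (\<pi> z)) = (\<lambda>z. e (\<pi> z))(x := d)" for d by auto
  with Exists show ?case by simp
qed auto

text \<open>By \<open>sat_rename\<close>, renaming a formula amounts to re-indexing \<open>c\<close>
  and \<open>e\<close>, and validity quantifies over both.\<close>

lemma stable_rename: "stable F \<Longrightarrow> stable (rename \<pi> \<rho> F)"
  unfolding stable_def valid_def elementarization_rename sat_rename by (simp add: image_subset_iff)

lemma rule_A_premises_rename:
  assumes "rule_A_premises Hs F"
  shows "rule_A_premises (rename \<pi> \<rho> ` Hs) (rename \<pi> \<rho> F)"
  unfolding rule_A_premises_def
proof (intro conjI allI impI ballI)
  fix C Gs G
  assume "rename \<pi> \<rho> F = fill C (ChAnd Gs) \<and> positive C \<or>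
      rename \<pi> \<rho> F = fill C (ChOr Gs) \<and> negative C" and "G \<in> set Gs"
  then have "fill (rename_sctx \<pi> \<rho> C) (rename \<pi> \<rho> G) \<in> Hs"
    using assms unfolding rule_A_premises_def rename_eq_fill_iff
    by (metis image_eqI image_set positive_rename_sctx rename.simps(8,9))
  then show "fill C G \<in> rename \<pi> \<rho> ` Hs"
    by (rule rev_image_eqI) (simp add: rename_fill)
next
  fix C x G
  assume "rename \<pi> \<rho> F = fill C (ChAll x G) \<and> positive C \<or>
      rename \<pi> \<rho> F = fill C (ChEx x G) \<and> negative C"
  then obtain y where y: "y \<notin> vars F"
    "fill (rename_sctx \<pi> \<rho> C) (subst (\<pi> x) (Var y) (rename \<pi> \<rho> G)) \<in> Hs"
    using assms unfolding rule_A_premises_def rename_eq_fill_iff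
    by (metis positive_rename_sctx rename.simps(12,13))
  have "fill C (subst x (Var (\<pi> y)) G) \<in> rename \<pi> \<rho> ` Hs"
    using y(2) by (rule rev_image_eqI) (simp add: rename_fill rename_subst)
  moreover have "\<pi> y \<notin> vars (rename \<pi> \<rho> F)" using y(1) by (auto simp: vars_rename)
  ultimately show "\<exists>y. y \<notin> vars (rename \<pi> \<rho> F) \<and> fill C (subst x (Var y) G) \<in> rename \<pi> \<rho> ` Hs"
    by blast
qed

lemma CL2_rename: "CL2 F \<Longrightarrow> CL2 (rename \<pi> \<rho> F)"
proof (induction rule: CL2.induct)
  case (A F Hs)
  then show ?case
    by (intro CL2.A[where Hs = "rename \<pi> \<rho> ` Hs"] stable_rename rule_A_premises_rename) auto
next
  case (B1 F C Gs G)
  show ?case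
    by (rule CL2.B1[where C = "rename_sctx \<pi> \<rho> C" and Gs = "map (rename \<pi> \<rho>) Gs"
          and G = "rename \<pi> \<rho> G"]) (use B1 in \<open>auto simp: rename_fill\<close>)
next
  case (B2 F C x G t)
  have t: "\<forall>y. rename_trm \<pi> \<rho> t = Var y \<longrightarrow>
      y \<notin> binders (rename_sctx \<pi> \<rho> C) \<and> free_for (\<pi> x) y (rename \<pi> \<rho> G)"
  proof (intro allI impI)
    fix y assume "rename_trm \<pi> \<rho> t = Var y"
    then obtain z where "t = Var z" "y = \<pi> z" by (metis mem_vars_rename_trm)
    with B2.hyps(3) show "y \<notin> binders (rename_sctx \<pi> \<rho> C) \<and> free_for (\<pi> x) y (rename \<pi> \<rho> G)"
      by (auto simp: binders_rename_sctx free_for_rename)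
  qed
  show ?case
    by (rule CL2.B2[where C = "rename_sctx \<pi> \<rho> C" and x = "\<pi> x" and G = "rename \<pi> \<rho> G"
          and t = "rename_trm \<pi> \<rho> t"]) (use B2 t in \<open>auto simp: rename_fill rename_subst\<close>)
qed

text \<open>Since \<open>F\<close> is fixed, so are \<open>C\<close>, \<open>x\<close> and
  \<open>G\<close>; only the inserted term moves. This exchanges the term in a premise while the
  conclusion stays the same.\<close>

lemma CL2_rename_instance:
  assumes "rename \<pi> \<rho> F = F" "F = fill C (ChAll x G) \<or> F = fill C (ChEx x G)"
    and "CL2 (fill C (subst x t G))"
  shows "CL2 (fill C (subst x (rename_trm \<pi> \<rho> t) G))"
proof -
  have "rename_sctx \<pi> \<rho> C = C \<and> \<pi> x = x \<and> rename \<pi> \<rho> G = G"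
    using assms(1,2) rename_fill_fixed[of \<pi> \<rho> C "ChAll x G"]
      rename_fill_fixed[of \<pi> \<rho> C "ChEx x G"]
    by (auto simp: rename_fill)
  with CL2_rename[OF assms(3)] show ?thesis by (simp add: rename_fill rename_subst)
qed

end

section \<open>Goedel numbers bound the variables and constants of a formula\<close>

lemma le_list_encode: "n \<in> set ns \<Longrightarrow> n \<le> list_encode ns"
  by (induction ns) (auto intro: le_SucI le_prod_encode_1 order_trans[OF _ le_prod_encode_2])

lemma fm_code_kids: "K \<in> set (kids F) \<Longrightarrow> fm_code K \<le> fm_code F"
proof (cases F)
  case (Imp G H)
  assume "K \<in> set (kids F)"
  with Imp show ?thesis
    by (auto intro: order_trans[OF le_prod_encode_1 le_prod_encode_2]
        order_trans[OF le_prod_encode_2 le_prod_encode_2])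
qed (auto intro: le_prod_encode_2 order_trans[OF le_list_encode le_prod_encode_2]
    order_trans[OF le_prod_encode_2 le_prod_encode_2])

lemma fm_code_mem:
  assumes "G \<in> set Gs"
  shows "fm_code G \<le> fm_code (Conj Gs)" "fm_code G \<le> fm_code (Disj Gs)"
    "fm_code G \<le> fm_code (ChAnd Gs)" "fm_code G \<le> fm_code (ChOr Gs)"
  by (rule fm_code_kids, simp add: assms)+

lemma trm_code_Atom:
  assumes "t \<in> set ts" shows "trm_code t \<le> fm_code (Atom p ts)"
proof -
  have "trm_code t \<le> list_encode (map trm_code ts)" using assms by (intro le_list_encode) simp
  also have "\<dots> \<le> prod_encode (p, \<dots>)" by (rule le_prod_encode_2)
  also have "\<dots> \<le> prod_encode (0, \<dots>)" by (rule le_prod_encode_2)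
  finally show ?thesis by simp
qed

lemma var_le_fm_code:
  "x \<le> fm_code (Forall x G)" "x \<le> fm_code (Exists x G)"
  "x \<le> fm_code (ChAll x G)" "x \<le> fm_code (ChEx x G)"
  by (auto intro: order_trans[OF le_prod_encode_1 le_prod_encode_2])

lemma vars_le_fm_code: "x \<in> vars F \<Longrightarrow> x \<le> fm_code F"
proof (induction F)
  case (Atom p ts)
  then have "trm_code (Var x) \<le> fm_code (Atom p ts)" by (intro trm_code_Atom) simp
  then show ?case using le_prod_encode_2[of x 0] by simp
qed (auto simp del: fm_code.simps intro: order_trans[OF _ fm_code_kids] var_le_fm_code
    order_trans[OF _ fm_code_mem(1)] order_trans[OF _ fm_code_mem(2)]
    order_trans[OF _ fm_code_mem(3)] order_trans[OF _ fm_code_mem(4)])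

text \<open>Variables are controlled through \<open>vars\<close> and not through the code, because a
  variable that is fresh in rule A may well be smaller than the code.\<close>

lemma rename_id:
  "\<forall>x\<in>vars F. \<pi> x = x \<Longrightarrow> \<forall>k\<le>fm_code F. \<rho> k = k \<Longrightarrow> rename \<pi> \<rho> F = F"
proof (induction F)
  case (Atom p ts)
  have "rename_trm \<pi> \<rho> t = t" if t: "t \<in> set ts" for t
  proof (cases t)
    case (Var x)
    then show ?thesis using Atom(1) t by simp
  next
    case (Const k)
    then have "k \<le> fm_code (Atom p ts)"
      using trm_code_Atom[OF t, of p] le_prod_encode_2[of k 1] by (simp del: fm_code.simps)
    then show ?thesis using Atom(2) Const by simp
  qed
  then show ?case by (simp add: map_idI)
qed (simp_all add: map_idI order_trans[OF _ fm_code_kids] order_trans[OF _ fm_code_mem(1)]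
    order_trans[OF _ fm_code_mem(2)] order_trans[OF _ fm_code_mem(3)] order_trans[OF _ fm_code_mem(4)]
    del: fm_code.simps)

section \<open>Canonical premises\<close>

definition choice_fm :: "fm \<Rightarrow> bool" where
  "choice_fm E \<longleftrightarrow> fst (label E) \<in> {7, 8, 11, 12}"

lemma replace_one_iff:
  "(q, a, Hs) \<in> set (replace_one (map (\<lambda>G. (G, f G)) Gs)) \<longleftrightarrow>
    (\<exists>us G vs H. Gs = us @ G # vs \<and> Hs = us @ H # vs \<and> (q, a, H) \<in> set (f G))"
proof (induction Gs arbitrary: Hs)
  case (Cons K Gs)
  have "(q, a, Hs) \<in> set (replace_one (map (\<lambda>G. (G, f G)) (K # Gs))) \<longleftrightarrow>
      (\<exists>H. Hs = H # Gs \<and> (q, a, H) \<in> set (f K)) \<or>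
      (\<exists>Hs'. Hs = K # Hs' \<and> (q, a, Hs') \<in> set (replace_one (map (\<lambda>G. (G, f G)) Gs)))"
    by (auto simp: image_iff split_def comp_def Bex_def)
  then show ?case
    unfolding Cons.IH by (auto simp: Cons_eq_append_conv) blast+
qed simp

text \<open>Polarities multiply like signs, and equality of truth values is that product.\<close>

lemma moves_fill:
  "(q, a, E') \<in> set (moves N E) \<Longrightarrow> (q = positive C, a, fill C E') \<in> set (moves N (fill C E))"
proof (induction C)
  case (CConj Gs C Hs)
  then have "(q = positive C, a, Gs @ fill C E' # Hs) \<in>
      set (replace_one (map (\<lambda>G. (G, moves N G)) (Gs @ fill C E # Hs)))"
    unfolding replace_one_iff by blast
  then show ?case by (force simp del: map_append list.map)
next
  case (CDisj Gs C Hs)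
  then have "(q = positive C, a, Gs @ fill C E' # Hs) \<in>
      set (replace_one (map (\<lambda>G. (G, moves N G)) (Gs @ fill C E # Hs)))"
    unfolding replace_one_iff by blast
  then show ?case by (force simp del: map_append list.map)
qed (force simp: image_iff)+

definition arises :: "nat \<Rightarrow> fm \<Rightarrow> bool \<Rightarrow> bool \<Rightarrow> fm \<Rightarrow> bool" where
  "arises N F q a H \<longleftrightarrow> (\<exists>C E E' q'. choice_fm E \<and> F = fill C E \<and> H = fill C E' \<and>
     (q', a, E') \<in> set (moves N E) \<and> q = (q' = positive C))"

lemma arises_choice: "choice_fm E \<Longrightarrow> (q, a, H) \<in> set (moves N E) \<Longrightarrow> arises N E q a H"
  unfolding arises_def by (intro exI[of _ Hole] exI[of _ E] exI[of _ H] exI[of _ q]) simp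

text \<open>\<open>D\<close> puts one more layer around a context, \<open>d\<close> is its effect on
  formulas, and \<open>s\<close> tells whether the layer preserves polarity.\<close>

lemma arises_lift:
  assumes "arises N G q a K"
    and "\<And>C E. fill (D C) E = d (fill C E)" "\<And>C. positive (D C) = (s = positive C)"
  shows "arises N (d G) (q = s) a (d K)"
proof -
  obtain C E E' q' where "choice_fm E" "G = fill C E" "K = fill C E'"
    "(q', a, E') \<in> set (moves N E)" "q = (q' = positive C)"
    using assms(1) unfolding arises_def by blast
  then show ?thesis
    unfolding arises_def
    by (intro exI[of _ "D C"] exI[of _ E] exI[of _ E'] exI[of _ q']) (auto simp: assms(2,3))
qed

lemma movesD: "(q, a, H) \<in> set (moves N F) \<Longrightarrow> arises N F q a H"
proof (induction F arbitrary: q H)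
  case (Neg G)
  then obtain K where "H = Neg K" "arises N G (\<not> q) a K" by auto
  then show ?case using arises_lift[where D = CNeg and d = Neg and s = False] by fastforce
next
  case (Conj Gs)
  then obtain us G vs K where K: "Gs = us @ G # vs" "H = Conj (us @ K # vs)" "(q, a, K) \<in> set (moves N G)"
    by (auto simp: replace_one_iff)
  then have "arises N G q a K" using Conj.IH by simp
  from arises_lift[OF this, where D = "\<lambda>C. CConj us C vs" and d = "\<lambda>E. Conj (us @ E # vs)" and s = True]
  show ?case by (simp add: K)
next
  case (Disj Gs)
  then obtain us G vs K where K: "Gs = us @ G # vs" "H = Disj (us @ K # vs)" "(q, a, K) \<in> set (moves N G)"
    by (auto simp: replace_one_iff)
  then have "arises N G q a K" using Disj.IH by simp
  from arises_lift[OF this, where D = "\<lambda>C. CDisj us C vs" and d = "\<lambda>E. Disj (us @ E # vs)" and s = True]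
  show ?case by (simp add: K)
next
  case (Imp F G)
  then consider K where "H = Imp K G" "arises N F (\<not> q) a K"
    | K where "H = Imp F K" "arises N G q a K" by auto
  then show ?case
  proof cases
    case 1
    then show ?thesis
      using arises_lift[where D = "\<lambda>C. CImpL C G" and d = "\<lambda>E. Imp E G" and s = False] by fastforce
  next
    case 2
    then show ?thesis
      using arises_lift[where D = "CImpR F" and d = "Imp F" and s = True] by fastforce
  qed
next
  case (Forall x G)
  then obtain K where "H = Forall x K" "arises N G q a K" by auto
  then show ?case using arises_lift[where D = "CForall x" and d = "Forall x" and s = True] by fastforce
next
  case (Exists x G)
  then obtain K where "H = Exists x K" "arises N G q a K" by auto
  then show ?case using arises_lift[where D = "CExists x" and d = "Exists x" and s = True] by fastforce
qed (simp_all add: arises_choice choice_fm_def del: moves.simps(8,9,12,13))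

text \<open>A formula is a positive occurrence in itself, so the entries flagged \<open>True\<close>
  are the moves that matter for it; \<open>a\<close> then separates rule A from rules B1 and
  B2.\<close>

lemma moves_True_cases:
  assumes "(True, a, H) \<in> set (moves N F)"
  obtains (A1) C Gs G where "a" "H = fill C G" "G \<in> set Gs"
      "F = fill C (ChAnd Gs) \<and> positive C \<or> F = fill C (ChOr Gs) \<and> negative C"
  | (A2) C x G where "a" "H = fill C (subst x (Var N) G)"
      "F = fill C (ChAll x G) \<and> positive C \<or> F = fill C (ChEx x G) \<and> negative C"
  | (B1) C Gs G where "\<not> a" "H = fill C G" "G \<in> set Gs"
      "F = fill C (ChAnd Gs) \<and> negative C \<or> F = fill C (ChOr Gs) \<and> positive C"
  | (B2) C x G t where "\<not> a" "H = fill C (subst x t G)" "t \<in> set (witnesses N x G)"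
      "F = fill C (ChAll x G) \<and> negative C \<or> F = fill C (ChEx x G) \<and> positive C"
proof -
  obtain C E E' q where E: "choice_fm E" "F = fill C E" "H = fill C E'"
    "(q, a, E') \<in> set (moves N E)" "q = positive C"
    using movesD[OF assms] unfolding arises_def by auto
  then show thesis
    by (cases E) (auto simp: choice_fm_def intro: that)
qed

section \<open>Termination measure and invariants of the recursion\<close>

fun choices :: "fm \<Rightarrow> nat" where
  "choices (Neg G) = choices G"
| "choices (Conj Gs) = sum_list (map (\<lambda>G. choices G) Gs)"
| "choices (Disj Gs) = sum_list (map (\<lambda>G. choices G) Gs)"
| "choices (Imp G H) = choices G + choices H"
| "choices (ChAnd Gs) = Suc (sum_list (map (\<lambda>G. choices G) Gs))"
| "choices (ChOr Gs) = Suc (sum_list (map (\<lambda>G. choices G) Gs))"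
| "choices (Forall x G) = choices G"
| "choices (Exists x G) = choices G"
| "choices (ChAll x G) = Suc (choices G)"
| "choices (ChEx x G) = Suc (choices G)"
| "choices _ = 0"

lemma choices_subst [simp]: "choices (subst x t G) = choices G"
  by (induction G) (simp_all add: comp_def cong: map_cong)

lemma wff_subst [simp]: "wff (subst x t G) = wff G"
  by (induction G) auto

lemma blind_free_subst [simp]: "blind_free (subst x t G) = blind_free G"
  by (induction G) auto

lemma choices_fill: "choices E' < choices E \<Longrightarrow> choices (fill C E') < choices (fill C E)"
  by (induction C) auto

lemma wff_fill: "wff (fill C E) \<Longrightarrow> (wff E \<Longrightarrow> wff E') \<Longrightarrow> wff (fill C E')"
  by (induction C) auto

lemma blind_free_fill:
  "blind_free (fill C E) \<Longrightarrow> (blind_free E \<Longrightarrow> blind_free E') \<Longrightarrow> blind_free (fill C E')"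
  by (induction C) auto

lemma binders_blind_free: "blind_free (fill C E) \<Longrightarrow> binders C = {}"
  by (induction C) auto

lemma moves_True_decrease:
  assumes "(True, a, H) \<in> set (moves N F)"
  shows "choices H < choices F" "wff F \<Longrightarrow> wff H" "blind_free F \<Longrightarrow> blind_free H"
proof -
  have le: "choices G < Suc (sum_list (map choices Gs))" if "G \<in> set Gs" for G Gs
    using member_le_sum_list[of "choices G" "map choices Gs"] that by simp
  show "choices H < choices F"
    using assms by (cases rule: moves_True_cases) (auto intro!: choices_fill le)
  show "wff H" if "wff F"
    using assms that by (cases rule: moves_True_cases) (auto elim!: wff_fill)
  show "blind_free H" if "blind_free F"
    using assms that by (cases rule: moves_True_cases) (auto elim!: blind_free_fill)
qed

lemma mem_witnesses [simp]:
  "Const k \<in> set (witnesses N x G) \<longleftrightarrow> k \<le> N"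
  "Var y \<in> set (witnesses N x G) \<longleftrightarrow> y \<le> N \<and> free_for x y G"
  by (auto simp: witnesses_def simp del: upt_Suc)

text \<open>The recursion equation of the decision procedure. From left to right, swaps carry the
  premises of a given derivation to the enumerated ones; from right to left, the enumerated formulas
  serve directly as premises.\<close>

lemma CL2_iff_moves:
  assumes F: "wff F" "blind_free F"
  defines "M \<equiv> set (moves (Suc (fm_code F)) F)"
  shows "CL2 F \<longleftrightarrow> stable F \<and> (\<forall>H. (True, True, H) \<in> M \<longrightarrow> CL2 H) \<or>
    (\<exists>H. (True, False, H) \<in> M \<and> CL2 H)" (is "_ \<longleftrightarrow> ?rhs")
proof -
  let ?N = "Suc (fm_code F)"
  have N: "?N \<notin> vars F" using vars_le_fm_code[of ?N F] by auto
  let ?swap = "\<lambda>y. id(y := ?N, ?N := y)"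
  have move: "(b, a, fill C E') \<in> M" if "F = fill C E" "(q, a, E') \<in> set (moves ?N E)" "b = (q = positive C)"
    for b a C E E' q
    using moves_fill[OF that(2), of C] that(1,3) by (simp add: M_def)
  show ?thesis
  proof
    assume "CL2 F"
    then show ?rhs
    proof (cases rule: CL2.cases)
      case (A Hs)
      have "CL2 H" if "(True, True, H) \<in> M" for H
        using that unfolding M_def
      proof (cases rule: moves_True_cases)
        case (A1 C Gs G)
        then have "H \<in> Hs" using A(3) unfolding rule_A_premises_def by blast
        then show ?thesis using A(4) by blast
      next
        case (A2 C x G)
        then obtain y where y: "y \<notin> vars F" "fill C (subst x (Var y) G) \<in> Hs"
          using A(3) unfolding rule_A_premises_def by blast
        \<comment> \<open>Neither \<open>y\<close> nor \<open>?N\<close> occurs in \<open>F\<close>,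
          so exchanging them fixes \<open>F\<close> and turns the fresh variable used in the
          derivation into the canonical one.\<close>
        interpret involutive_renaming "?swap y" id
          by standard auto
        have "rename (?swap y) id F = F"
          using y(1) N by (intro rename_id) auto
        moreover have "F = fill C (ChAll x G) \<or> F = fill C (ChEx x G)" using A2(3) by blast
        moreover have "CL2 (fill C (subst x (Var y) G))" using y(2) A(4) by blast
        ultimately have "CL2 (fill C (subst x (rename_trm (?swap y) id (Var y)) G))"
          by (rule CL2_rename_instance)
        moreover have "rename_trm (?swap y) id (Var y) = Var ?N" by simp
        ultimately show ?thesis using A2(2) by metis
      qed simp_all
      with A(2) show ?thesis by blast
    next
      case (B1 C Gs G)
      have "(True, False, fill C G) \<in> M"
        using B1(2,3) move[where E = "ChAnd Gs" and q = False and b = True]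
          move[where E = "ChOr Gs" and q = True and b = True] by auto
      with B1(4) show ?thesis by blast
    next
      case (B2 C x G t)
      have inst: "F = fill C (ChAll x G) \<or> F = fill C (ChEx x G)" using B2(2) by blast
      have "(True, False, fill C (subst x s G)) \<in> M" if "s \<in> set (witnesses ?N x G)" for s
        using B2(2) that move[where E = "ChAll x G" and q = False and b = True]
          move[where E = "ChEx x G" and q = True and b = True] by auto
      moreover have "\<exists>s\<in>set (witnesses ?N x G). CL2 (fill C (subst x s G))"
      proof (cases "t \<in> set (witnesses ?N x G)")
        case True
        with B2(4) show ?thesis by blast
      next
        case False
        show ?thesis
        proof (cases t)
          case (Const k)
          with False have k: "?N < k" by auto
          interpret involutive_renaming id "?swap k"
            by standard auto
          have "rename id (?swap k) F = F"
            using k by (intro rename_id) auto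
          from CL2_rename_instance[OF this inst B2(4)] Const
          have "CL2 (fill C (subst x (Const ?N) G))" using k by simp
          then show ?thesis by (intro bexI[of _ "Const ?N"]) simp_all
        next
          case (Var y)
          \<comment> \<open>The variable passes the capture test, so it can be missing from the list
            only for exceeding the bound; hence it does not occur in \<open>F\<close>.\<close>
          have "free_for x y G" using B2(3) Var by blast
          with False Var have y: "?N < y" by auto
          interpret involutive_renaming "?swap y" id
            by standard auto
          have fix': "rename (?swap y) id F = F"
            using y N vars_le_fm_code[of y F] by (intro rename_id) auto
          from CL2_rename_instance[OF this inst B2(4)] Var
          have "CL2 (fill C (subst x (Var ?N) G))" using y by simp
          \<comment> \<open>The side condition travels along the same swap, which fixes both
            \<open>x\<close> and \<open>G\<close>.\<close>
          moreover have "free_for x ?N G"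
          proof -
            have "?swap y x = x \<and> rename (?swap y) id G = G"
              using fix' inst rename_fill_fixed[of "?swap y" id C "ChAll x G"]
                rename_fill_fixed[of "?swap y" id C "ChEx x G"]
              by (auto simp: rename_fill simp del: fun_upd_apply)
            with free_for_rename[of x y G] \<open>free_for x y G\<close> y show ?thesis by simp
          qed
          ultimately show ?thesis by (intro bexI[of _ "Var ?N"]) simp_all
        qed
      qed
      ultimately show ?thesis by blast
    qed
  next
    assume ?rhs
    then show "CL2 F"
    proof
      assume *: "stable F \<and> (\<forall>H. (True, True, H) \<in> M \<longrightarrow> CL2 H)"
      have "rule_A_premises {H. (True, True, H) \<in> M} F"
        unfolding rule_A_premises_def
      proof (intro conjI allI impI ballI)
        fix C Gs G
        assume "F = fill C (ChAnd Gs) \<and> positive C \<or> F = fill C (ChOr Gs) \<and> negative C" "G \<in> set Gs"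
        then show "fill C G \<in> {H. (True, True, H) \<in> M}"
          using move[where E = "ChAnd Gs" and q = True and b = True]
            move[where E = "ChOr Gs" and q = False and b = True] by auto
      next
        fix C x G
        assume "F = fill C (ChAll x G) \<and> positive C \<or> F = fill C (ChEx x G) \<and> negative C"
        then have "fill C (subst x (Var ?N) G) \<in> {H. (True, True, H) \<in> M}"
          using move[where E = "ChAll x G" and q = True and b = True]
            move[where E = "ChEx x G" and q = False and b = True] by auto
        with N show "\<exists>y. y \<notin> vars F \<and> fill C (subst x (Var y) G) \<in> {H. (True, True, H) \<in> M}" by blast
      qed
      with * F(1) show ?thesis by (auto intro: CL2.A)
    next
      assume "\<exists>H. (True, False, H) \<in> M \<and> CL2 H"
      then obtain H where "(True, False, H) \<in> set (moves ?N F)" and H: "CL2 H"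
        unfolding M_def by blast
      then show ?thesis
      proof (cases rule: moves_True_cases)
        case (B1 C Gs G)
        with H F(1) show ?thesis by (auto intro: CL2.B1)
      next
        case (B2 C x G t)
        \<comment> \<open>This supplies the part of the side condition of B2 that
          \<open>witnesses\<close> does not test.\<close>
        have "binders C = {}" using B2(4) F(2) binders_blind_free by blast
        with B2(3) have "\<forall>y. t = Var y \<longrightarrow> y \<notin> binders C \<and> free_for x y G"
          by auto
        from CL2.B2[OF F(1) B2(4) this] show ?thesis using H B2(2) by simp
      qed simp_all
    qed
  qed
qed

theorem theorem5p7:
  shows "\<exists>decider. \<forall>F. wff F \<and> blind_free F \<longrightarrow>
    computes decider [fm_code F] (if CL2 F then 1 else 0)"
proof -
  define ms where "ms F = filter fst (moves (Suc (enc F)) F)" for F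
  \<comment> \<open>\<open>bs\<close> lists the verdicts on the candidate premises in the order of
    \<open>ms F\<close>. Zipping restores the rule flag of each: all rule A candidates must succeed,
    together with stability, or some rule B candidate.\<close>
  define G where "G F bs \<longleftrightarrow>
      (\<forall>S\<in>set (subseqs (atoms F)). peval S F) \<and> (\<forall>(m, b)\<in>set (zip (ms F) bs). fst (snd m) \<longrightarrow> b) \<or>
      (\<exists>(m, b)\<in>set (zip (ms F) bs). \<not> fst (snd m) \<and> b)" for F bs
  have "computable_on {F. wff F \<and> blind_free F} CL2"
  proof (rule computable_on_rec[where G = G and m = choices])
    show "computable (\<lambda>F. map (\<lambda>m. snd (snd m)) (ms F))"
      unfolding ms_def by (intro computable_fm_intros computable_moves)
    show "computable (\<lambda>z. G (fst z) (snd z))"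
      unfolding G_def ms_def
      by (intro computable_fm_intros computable_moves computable_atoms computable_peval)
  next
    fix F assume "F \<in> {F. wff F \<and> blind_free F}"
    then have F: "wff F" "blind_free F" by auto
    have "zip xs (map f (map g xs)) = map (\<lambda>x. (x, f (g x))) xs"
      for f :: "fm \<Rightarrow> bool" and g and xs :: "(bool \<times> bool \<times> fm) list"
      by (simp add: zip_map2 zip_same_conv_map)
    then show "CL2 F = G F (map CL2 (map (\<lambda>m. snd (snd m)) (ms F)))"
      unfolding CL2_iff_moves[OF F] G_def stable_iff_peval[OF F(2)] by (fastforce simp: ms_def)
  next
    fix F H assume "F \<in> {F. wff F \<and> blind_free F}" "H \<in> set (map (\<lambda>m. snd (snd m)) (ms F))"
    then show "H \<in> {F. wff F \<and> blind_free F} \<and> choices H < choices F"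
      using moves_True_decrease[of _ H "Suc (enc F)" F] by (auto simp: ms_def)
  qed
  then show ?thesis unfolding computable_on_def by auto
qed

end
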